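(* For any graph $G$ we have $\operatorname{pn}_\ell(G) \leq \operatorname{sa}_\ell(G)$ and $\operatorname{pn}_u(G) \leq \operatorname{sa}(G)$. In particular, \[ \frac{\operatorname{mad}(G)}{4} \leq \operatorname{pn}_\ell(G) \leq \frac{\operatorname{mad}(G)}{2}+2 \quad \text{ and } \quad \frac{\operatorname{mad}(G)}{4} \leq \operatorname{pn}_u(G) \leq \operatorname{mad}(G)+2. \]
   Context: All graphs are finite and simple (with at least one edge where quantities require it). A linear embedding of $G=(V,E)$ is a pair $(\prec,\mathcal{P})$ where $\prec$ is a total ordering of $V$ and $\mathcal{P}$ is a partition of $E$ into parts called pages. Two edges $uv, xy$ with $u\prec v$, $x \prec y$ cross if $u \prec x \prec v \prec y$ or $x \prec u \prec y \prec v$. A book embedding is a linear embedding in which no two crossing edges lie on the same page. For a book embedding and vertex $v$, $\mathcal{P}_v$ is the set of pages containing an edge incident to $v$; the embedding is $k$-local if $|\mathcal{P}_v|\le k$ for all $v$; $\operatorname{pn}_\ell(G)$ is the smallest $k$ such that $G$ admits a $k$-local book embedding. For a page $P$, $G_P$ is the subgraph formed by the edges of $P$ and the vertices incident to them. A union embedding is a linear embedding such that for every page $P$ and every connected component $C$ of $G_P$, no two edges of $C$ cross; $\operatorname{pn}_u(G)$ is the smallest number of pages of a union embedding of $G$. The maximum average degree is $\operatorname{mad}(G) = \max\{2|E(H)|/|V(H)| : H \subseteq G, H \ne \emptyset\}$. The star arboricity $\operatorname{sa}(G)$ is the minimum $k$ such that $E(G)$ can be partitioned into $k$ star forests (forests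 each of whose components is a star). The local star arboricity $\operatorname{sa}_\ell(G)$ is the minimum $k$ such that $E(G)$ can be partitioned into some number of stars with each vertex incident to edges of at most $k$ of these stars. *)

theory Defs
  imports Complex_Main "HOL-Library.Disjoint_Sets"
begin

definition graph :: "'a set \<Rightarrow> 'a set set \<Rightarrow> bool" where
  "graph V E \<longleftrightarrow> finite V \<and> (\<forall>e\<in>E. \<exists>u v. u \<noteq> v \<and> u \<in> V \<and> v \<in> V \<and> e = {u, v})"

definition vertex_order :: "'a set \<Rightarrow> 'a rel \<Rightarrow> bool" where
  "vertex_order V r \<longleftrightarrow> r \<subseteq> V \<times> V \<and> linear_order_on V r"

definition prec :: "'a rel \<Rightarrow> 'a \<Rightarrow> 'a \<Rightarrow> bool" where
  "prec r u v \<longleftrightarrow> (u, v) \<in> r \<and> u \<noteq> v"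

definition linear_embedding :: "'a set \<Rightarrow> 'a set set \<Rightarrow> 'a rel \<Rightarrow> 'a set set set \<Rightarrow> bool" where
  "linear_embedding V E r P \<longleftrightarrow> vertex_order V r \<and> partition_on E P"

definition cross :: "'a rel \<Rightarrow> 'a set \<Rightarrow> 'a set \<Rightarrow> bool" where
  "cross r e f \<longleftrightarrow>
     (\<exists>u v x y. prec r u v \<and> prec r x y \<and> e = {u, v} \<and> f = {x, y} \<and>
        ((prec r u x \<and> prec r x v \<and> prec r v y) \<or> (prec r x u \<and> prec r u y \<and> prec r y v)))"

definition book_embedding :: "'a set \<Rightarrow> 'a set set \<Rightarrow> 'a rel \<Rightarrow> 'a set set set \<Rightarrow> bool" where
  "book_embedding V E r P \<longleftrightarrow> linear_embedding V E r P \<and>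
     (\<forall>p\<in>P. \<forall>e\<in>p. \<forall>f\<in>p. \<not> cross r e f)"

definition pages_at :: "'a set set set \<Rightarrow> 'a \<Rightarrow> 'a set set set" where
  "pages_at P v = {p \<in> P. \<exists>e\<in>p. v \<in> e}"

definition k_local :: "nat \<Rightarrow> 'a set \<Rightarrow> 'a set set set \<Rightarrow> bool" where
  "k_local k V P \<longleftrightarrow> (\<forall>v\<in>V. card (pages_at P v) \<le> k)"

definition local_page_number :: "'a set \<Rightarrow> 'a set set \<Rightarrow> nat" where
  "local_page_number V E = (LEAST k. \<exists>r P. book_embedding V E r P \<and> k_local k V P)"

definition same_component :: "'a set set \<Rightarrow> 'a set \<Rightarrow> 'a set \<Rightarrow> bool" where
  "same_component p e f \<longleftrightarrow> (\<exists>u\<in>e. \<exists>w\<in>f. (\<lambda>a b. {a, b} \<in> p)\<^sup>*\<^sup>* u w)"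

definition union_embedding :: "'a set \<Rightarrow> 'a set set \<Rightarrow> 'a rel \<Rightarrow> 'a set set set \<Rightarrow> bool" where
  "union_embedding V E r P \<longleftrightarrow> linear_embedding V E r P \<and>
     (\<forall>p\<in>P. \<forall>e\<in>p. \<forall>f\<in>p. same_component p e f \<longrightarrow> \<not> cross r e f)"

definition union_page_number :: "'a set \<Rightarrow> 'a set set \<Rightarrow> nat" where
  "union_page_number V E = (LEAST k. \<exists>r P. union_embedding V E r P \<and> card P = k)"

definition mad :: "'a set \<Rightarrow> 'a set set \<Rightarrow> real" where
  "mad V E = Max {2 * real (card E') / real (card V') | V' E'.
                    V' \<subseteq> V \<and> V' \<noteq> {} \<and> E' \<subseteq> E \<and> (\<forall>e\<in>E'. e \<subseteq> V')}"

definition is_star :: "'a set set \<Rightarrow> bool" where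
  "is_star S \<longleftrightarrow> S \<noteq> {} \<and> (\<exists>c. \<forall>e\<in>S. c \<in> e)"

definition star_forest :: "'a set set \<Rightarrow> bool" where
  "star_forest F \<longleftrightarrow> (\<forall>e\<in>F. is_star {f \<in> F. same_component F e f})"

definition star_arboricity :: "'a set set \<Rightarrow> nat" where
  "star_arboricity E = (LEAST k. \<exists>Q. partition_on E Q \<and> card Q = k \<and> (\<forall>F\<in>Q. star_forest F))"

definition local_star_arboricity :: "'a set \<Rightarrow> 'a set set \<Rightarrow> nat" where
  "local_star_arboricity V E = (LEAST k. \<exists>Q. partition_on E Q \<and> (\<forall>S\<in>Q. is_star S) \<and>
      (\<forall>v\<in>V. card {S \<in> Q. \<exists>e\<in>S. v \<in> e} \<le> k))"

end

theory Submission
  imports Defs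
begin

text \<open>Edges sharing a vertex never cross, so stars and star forests may serve as pages for any
  vertex order. For the lower bounds, in a page in which no two crossing edges are joined by a
  third one every edge is the longest one at one of its ends on the side of the other end, so
  there are at most twice as many edges as vertices.

  For the upper bounds put \<open>m = mad / 2\<close>. By matroid union the edges can be oriented with outdegree
  at most \<open>\<lceil>m\<rceil>\<close>; the stars of incoming edges then give local star arboricity at most \<open>\<lceil>m\<rceil> + 1\<close>.
  Matroid union also yields the theorem of Nash-Williams, by which \<open>E\<close> is covered by
  \<open>K = \<lfloor>m + 3/2\<rfloor>\<close> forests. Splitting all of them into two star forests would cost \<open>2K\<close> pages,
  which may exceed \<open>mad + 2\<close>. Instead the vertex order is chosen so that one forest is free of
  crossings; this saves one page, and \<open>2K - 1 \<le> mad + 2\<close>.\<close>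

subsection \<open>Stars and star forests as pages\<close>

lemma graphE:
  assumes "graph V E" "e \<in> E"
  obtains u v where "u \<noteq> v" "u \<in> V" "v \<in> V" "e = {u, v}"
  using assms unfolding graph_def by blast

lemma graph_finite_edges: "graph V E \<Longrightarrow> finite E"
  by (rule finite_subset[of _ "Pow V"]) (auto simp: graph_def)

lemma graph_edges_subset: "graph V E \<Longrightarrow> e \<in> E \<Longrightarrow> e \<subseteq> V"
  by (auto simp: graph_def)

lemma graph_subset: "graph V E \<Longrightarrow> X \<subseteq> E \<Longrightarrow> graph V X"
  by (auto simp: graph_def)

text \<open>A crossing puts four vertices in strict order, so they are distinct. Pages made of stars
  or star forests need nothing else about crossings.\<close>

lemma cross_disjoint:
  assumes "vertex_order V r" "cross r e f"
  shows "e \<inter> f = {}"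
proof -
  have "antisym r"
    using assms(1) by (simp add: vertex_order_def linear_order_on_def partial_order_on_def)
  moreover have "trans r"
    using assms(1) by (simp add: vertex_order_def linear_order_on_def partial_order_on_def preorder_on_def)
  ultimately have irr: "\<And>x y. prec r x y \<Longrightarrow> x \<noteq> y"
    and tr: "\<And>x y z. prec r x y \<Longrightarrow> prec r y z \<Longrightarrow> prec r x z"
    unfolding prec_def by (blast, metis antisymD transD)
  show ?thesis
    using assms(2) unfolding cross_def by (auto dest: tr irr)
qed

lemma vertex_order_exists: "\<exists>r. vertex_order V r"
proof -
  obtain r where "well_order_on V r" using well_order_on by blast
  then have "linear_order_on V r" by (simp add: well_order_on_def)
  moreover from this have "r \<subseteq> V \<times> V"
    by (auto simp: linear_order_on_def partial_order_on_def preorder_on_def refl_on_def)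
  ultimately show ?thesis unfolding vertex_order_def by blast
qed

text \<open>Orders are built from injective labels because \<open>forest_order\<close> places one
  vertex next to another by giving it a nearby real label.\<close>

lemma vertex_order_inj:
  fixes g :: "'a \<Rightarrow> 'b::linorder"
  assumes "inj_on g V"
  shows "vertex_order V {(x, y). x \<in> V \<and> y \<in> V \<and> g x \<le> g y}"
  using assms
  by (auto simp: vertex_order_def linear_order_on_def partial_order_on_def preorder_on_def
      refl_on_def trans_def antisym_def total_on_def inj_on_def)

lemma prec_inj:
  fixes g :: "'a \<Rightarrow> 'b::linorder"
  assumes "inj_on g V"
  shows "prec {(x, y). x \<in> V \<and> y \<in> V \<and> g x \<le> g y} x y \<longleftrightarrow> x \<in> V \<and> y \<in> V \<and> g x < g y"
  using assms by (auto simp: prec_def inj_on_def order.order_iff_strict)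

lemma same_component_if_meet:
  assumes "e \<inter> f \<noteq> {}" shows "same_component p e f"
  using assms unfolding same_component_def by blast

lemma same_component_via_edge:
  assumes "g \<in> p" "g = {a, b}" "a \<in> e" "b \<in> f"
  shows "same_component p e f"
  using assms unfolding same_component_def by blast

text \<open>Page assignments are given as colourings \<open>h\<close>. Only colours that occur index
  the classes, since the parts of a partition must be nonempty.\<close>

lemma fibres_partition:
  "partition_on E ((\<lambda>i. {e \<in> E. h e = i}) ` (h ` E))"
  by (rule partition_onI) (auto simp: disjnt_def)

lemma singletons_partition: "partition_on E ((\<lambda>e. {e}) ` E)"
  by (rule partition_onI) (auto simp: disjnt_def)

lemma star_partition_exists:
  assumes "graph V E"
  shows "\<exists>Q. partition_on E Q \<and> (\<forall>S\<in>Q. is_star S)"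
proof (intro exI conjI)
  show "\<forall>S\<in>(\<lambda>e. {e}) ` E. is_star S"
    using assms by (auto simp: is_star_def graph_def)
qed (rule singletons_partition)

text \<open>\<open>LEAST\<close> is informative only if some value qualifies. Single edges are
  stars, and for a finite \<open>Q\<close> the bound \<open>card Q\<close> holds at every
  vertex.\<close>

lemma local_star_arboricity_witness:
  assumes "graph V E"
  obtains Q where "partition_on E Q" "\<forall>S\<in>Q. is_star S"
    "\<forall>v\<in>V. card {S \<in> Q. \<exists>e\<in>S. v \<in> e} \<le> local_star_arboricity V E"
proof -
  obtain Q where Q: "partition_on E Q" "\<forall>S\<in>Q. is_star S"
    using star_partition_exists[OF assms] by blast
  have "finite Q" using Q(1) graph_finite_edges[OF assms] by (metis finite_elements)
  then have "\<exists>k Q. partition_on E Q \<and> (\<forall>S\<in>Q. is_star S) \<and>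
      (\<forall>v\<in>V. card {S \<in> Q. \<exists>e\<in>S. v \<in> e} \<le> k)"
    using Q by (intro exI[of _ "card Q"] exI[of _ Q]) (auto intro: card_mono)
  from LeastI_ex[OF this] show ?thesis using that unfolding local_star_arboricity_def by blast
qed

lemma star_arboricity_witness:
  assumes "graph V E"
  obtains Q where "partition_on E Q" "card Q = star_arboricity E" "\<forall>F\<in>Q. star_forest F"
proof -
  have "\<forall>F\<in>(\<lambda>e. {e}) ` E. star_forest F"
  proof
    fix F assume "F \<in> (\<lambda>e. {e}) ` E"
    then obtain e where e: "F = {e}" "e \<in> E" by blast
    then have "e \<noteq> {}" using assms by (auto simp: graph_def)
    then obtain c where "c \<in> e" by blast
    then have "{f \<in> F. same_component F e f} = {e}"
      using e same_component_if_meet[of e e] by auto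
    then show "star_forest F"
      using e \<open>c \<in> e\<close> by (auto simp: star_forest_def is_star_def)
  qed
  then have "\<exists>k Q. partition_on E Q \<and> card Q = k \<and> (\<forall>F\<in>Q. star_forest F)"
    using singletons_partition[of E] by blast
  from LeastI_ex[OF this] show ?thesis
    using that unfolding star_arboricity_def by blast
qed

lemma book_embedding_stars:
  assumes "vertex_order V r" "partition_on E Q" "\<forall>S\<in>Q. is_star S"
  shows "book_embedding V E r Q"
  unfolding book_embedding_def linear_embedding_def
proof (intro conjI ballI assms notI)
  fix S e f assume *: "S \<in> Q" "e \<in> S" "f \<in> S" "cross r e f"
  then obtain c where "c \<in> e" "c \<in> f" using assms(3) unfolding is_star_def by meson
  then show False using cross_disjoint[OF assms(1) *(4)] by blast
qed

text \<open>The edges of \<open>F\<close> in the component of \<open>e\<close> have a common centre,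
  and \<open>e\<close> is one of them. Thus connected edges of a star forest meet, and by
  \<open>cross_disjoint\<close> they do not cross.\<close>

lemma star_forest_share:
  assumes "star_forest F" "e \<in> F" "f \<in> F" "same_component F e f"
  shows "e \<inter> f \<noteq> {}"
proof -
  obtain c where c: "\<And>h. h \<in> F \<Longrightarrow> same_component F e h \<Longrightarrow> c \<in> h"
    using assms(1,2) unfolding star_forest_def is_star_def by blast
  have "e \<noteq> {}" using assms(4) unfolding same_component_def by blast
  then have "c \<in> e" using c[OF assms(2)] same_component_if_meet[of e e] by blast
  then show ?thesis using c[OF assms(3,4)] by blast
qed

lemma union_embedding_star_forests:
  assumes "vertex_order V r" "partition_on E Q" "\<forall>F\<in>Q. star_forest F"
  shows "union_embedding V E r Q"
  unfolding union_embedding_def linear_embedding_def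
proof (intro conjI ballI impI assms notI)
  fix F e f assume "F \<in> Q" "e \<in> F" "f \<in> F" "same_component F e f" "cross r e f"
  then show False
    using star_forest_share[of F e f] cross_disjoint[OF assms(1), of e f] assms(3) by simp
qed

section \<open>Page numbers against star arboricities\<close>

lemma local_page_number_le:
  assumes "book_embedding V E r P" "k_local k V P"
  shows "local_page_number V E \<le> k"
  unfolding local_page_number_def by (rule Least_le) (use assms in blast)

lemma union_page_number_le:
  assumes "union_embedding V E r P"
  shows "union_page_number V E \<le> card P"
  unfolding union_page_number_def by (rule Least_le) (use assms in blast)

lemma local_page_number_le_local_star_arboricity:
  assumes "graph V E"
  shows "local_page_number V E \<le> local_star_arboricity V E"
proof -
  obtain Q where Q: "partition_on E Q" "\<forall>S\<in>Q. is_star S"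
    "\<forall>v\<in>V. card {S \<in> Q. \<exists>e\<in>S. v \<in> e} \<le> local_star_arboricity V E"
    using local_star_arboricity_witness[OF assms] .
  obtain r where r: "vertex_order V r" using vertex_order_exists by blast
  show ?thesis
    using local_page_number_le[OF book_embedding_stars[OF r Q(1,2)]] Q(3)
    by (simp add: k_local_def pages_at_def)
qed

lemma union_page_number_le_star_arboricity:
  assumes "graph V E"
  shows "union_page_number V E \<le> star_arboricity E"
proof -
  obtain Q where Q: "partition_on E Q" "card Q = star_arboricity E" "\<forall>F\<in>Q. star_forest F"
    using star_arboricity_witness[OF assms] .
  obtain r :: "'a rel" where r: "vertex_order V r" using vertex_order_exists by blast
  show ?thesis
    using union_page_number_le[OF union_embedding_star_forests[OF r Q(1,3)]] Q(2) by simp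
qed

text \<open>The lower bound argues from an optimal embedding; pages that are stars show that the
  minimum is attained.\<close>

lemma local_page_number_witness:
  assumes "graph V E"
  obtains r P where "book_embedding V E r P" "k_local (local_page_number V E) V P"
proof -
  obtain Q where Q: "partition_on E Q" "\<forall>S\<in>Q. is_star S"
    "\<forall>v\<in>V. card {S \<in> Q. \<exists>e\<in>S. v \<in> e} \<le> local_star_arboricity V E"
    using local_star_arboricity_witness[OF assms] .
  obtain r where r: "vertex_order V r" using vertex_order_exists by blast
  have "\<exists>k r P. book_embedding V E r P \<and> k_local k V P"
    using book_embedding_stars[OF r Q(1,2)] Q(3) by (auto simp: k_local_def pages_at_def)
  from LeastI_ex[OF this] show ?thesis
    using that unfolding local_page_number_def by blast
qed

lemma union_page_number_witness:
  assumes "graph V E"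
  obtains r P where "union_embedding V E r P" "card P = union_page_number V E"
proof -
  obtain Q where Q: "partition_on E Q" "card Q = star_arboricity E" "\<forall>F\<in>Q. star_forest F"
    using star_arboricity_witness[OF assms] .
  obtain r :: "'a rel" where r: "vertex_order V r" using vertex_order_exists by blast
  have "\<exists>k r P. union_embedding V E r P \<and> card P = k"
    using union_embedding_star_forests[OF r Q(1,3)] by blast
  from LeastI_ex[OF this] show ?thesis
    using that unfolding union_page_number_def by blast
qed

subsection \<open>Maximum average degree and the lower bounds\<close>

text \<open>This makes the \<open>Max\<close> in \<open>mad\<close> meaningful; the edgeless
  subgraph on \<open>V\<close> supplies an element.\<close>

lemma mad_set:
  assumes "graph V E" "V \<noteq> {}"
  defines "M \<equiv> {2 * real (card E') / real (card V') | V' E'.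
                    V' \<subseteq> V \<and> V' \<noteq> {} \<and> E' \<subseteq> E \<and> (\<forall>e\<in>E'. e \<subseteq> V')}"
  shows "finite M" "M \<noteq> {}"
proof -
  have "M \<subseteq> (\<lambda>(V', E'). 2 * real (card E') / real (card V')) ` (Pow V \<times> Pow E)"
    unfolding M_def by auto
  moreover have "finite V" "finite E" using assms graph_finite_edges by (auto simp: graph_def)
  ultimately show "finite M" by (auto intro: finite_subset)
  have "2 * real (card ({}::'a set set)) / real (card V) \<in> M"
    unfolding M_def using assms(2) by blast
  then show "M \<noteq> {}" by blast
qed

lemma card_edges_le_mad:
  assumes "graph V E" "V \<noteq> {}" "V' \<subseteq> V" "E' \<subseteq> E" "\<And>e. e \<in> E' \<Longrightarrow> e \<subseteq> V'"
  shows "real (card E') \<le> mad V E / 2 * real (card V')"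
proof (cases "V' = {}")
  case True
  \<comment> \<open>\<open>mad\<close> ranges over nonempty \<open>V'\<close> only; here the bound
    holds because edges are nonempty and none fits into an empty vertex set.\<close>
  then have "E' = {}" using assms by (fastforce simp: graph_def)
  then show ?thesis using True by simp
next
  case False
  have "finite V'" using assms by (auto simp: graph_def intro: finite_subset)
  then have pos: "0 < card V'" using False by (simp add: card_gt_0_iff)
  have "2 * real (card E') / real (card V') \<le> mad V E"
    unfolding mad_def
    by (intro Max_ge mad_set CollectI exI[of _ V'] exI[of _ E']) (use assms False in blast)+
  then show ?thesis using pos by (simp add: field_simps)
qed

lemma mad_nonneg:
  assumes "graph V E" "V \<noteq> {}" shows "0 \<le> mad V E"
proof -
  have "finite V" using assms by (auto simp: graph_def)
  then have "0 < card V" using assms by (simp add: card_gt_0_iff)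
  then show ?thesis
    using card_edges_le_mad[OF assms, of V "{}"] by (simp add: zero_le_mult_iff)
qed

lemma mad_le:
  assumes "graph V E" "V \<noteq> {}"
    and "\<And>V' E'. V' \<subseteq> V \<Longrightarrow> E' \<subseteq> E \<Longrightarrow> (\<And>e. e \<in> E' \<Longrightarrow> e \<subseteq> V') \<Longrightarrow>
           real (card E') \<le> c * real (card V')"
  shows "mad V E \<le> 2 * c"
  unfolding mad_def
proof (subst Max_le_iff[OF mad_set[OF assms(1,2)]], intro ballI, elim CollectE exE conjE)
  fix x V' E' assume x: "x = 2 * real (card E') / real (card V')"
    and *: "V' \<subseteq> V" "V' \<noteq> {}" "E' \<subseteq> E" "\<forall>e\<in>E'. e \<subseteq> V'"
  from * have "finite V'" using assms by (auto simp: graph_def intro: finite_subset)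
  then have "0 < card V'" using * by (simp add: card_gt_0_iff)
  then show "x \<le> 2 * c"
    unfolding x using assms(3)[of V' E'] * by (simp add: field_simps)
qed

text \<open>Charge each such edge to \<open>u\<close>: it is the longest edge at \<open>u\<close> in
  direction \<open>R\<close>, and totality leaves at most one such edge per vertex. Keeping
  \<open>R\<close> general allows both \<open>prec r\<close> and its converse.\<close>

lemma card_extreme_edges_le:
  assumes "finite (\<Union>p)" "\<And>a b. a \<in> \<Union>p \<Longrightarrow> b \<in> \<Union>p \<Longrightarrow> a \<noteq> b \<Longrightarrow> R a b \<or> R b a"
  shows "card {e \<in> p. \<exists>u v. e = {u, v} \<and> R u v \<and> (\<forall>w. {u, w} \<in> p \<longrightarrow> R u w \<longrightarrow> \<not> R v w)}
           \<le> card (\<Union>p)"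
proof -
  let ?Q = "\<lambda>u e. e \<in> p \<and> (\<exists>v. e = {u, v} \<and> R u v \<and> (\<forall>w. {u, w} \<in> p \<longrightarrow> R u w \<longrightarrow> \<not> R v w))"
  have uniq: "e = f" if ef: "?Q u e" "?Q u f" for u e f
  proof -
    obtain v w where vw: "{u, v} \<in> p" "e = {u, v}" "R u v" "{u, w} \<in> p" "f = {u, w}" "R u w"
      "\<not> R v w" "\<not> R w v"
      using ef by blast
    then have "v = w" using assms(2)[of v w] by blast
    then show ?thesis using vw by blast
  qed
  have "{e \<in> p. \<exists>u v. e = {u, v} \<and> R u v \<and> (\<forall>w. {u, w} \<in> p \<longrightarrow> R u w \<longrightarrow> \<not> R v w)}
      \<subseteq> (\<lambda>u. THE e. ?Q u e) ` \<Union>p"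
  proof
    fix e
    assume "e \<in> {e \<in> p. \<exists>u v. e = {u, v} \<and> R u v \<and> (\<forall>w. {u, w} \<in> p \<longrightarrow> R u w \<longrightarrow> \<not> R v w)}"
    then obtain u where u: "?Q u e" "u \<in> e" by blast
    have "(THE e. ?Q u e) = e"
      using u(1) uniq[OF _ u(1)] by (rule the_equality)
    then show "e \<in> (\<lambda>u. THE e. ?Q u e) ` \<Union>p"
      using u by (intro image_eqI[of _ _ u]) auto
  qed
  then show ?thesis by (rule surj_card_le[OF assms(1)])
qed

text \<open>An edge that is neither the longest one to the right of its left end nor the longest one to
  the left of its right end joins two crossing edges.\<close>

lemma card_page_le:
  assumes G: "graph V p" and r: "vertex_order V r"
    and nc: "\<And>e f g. e \<in> p \<Longrightarrow> f \<in> p \<Longrightarrow> g \<in> p \<Longrightarrow> e \<inter> g \<noteq> {} \<Longrightarrow> f \<inter> g \<noteq> {} \<Longrightarrow> \<not> cross r e f"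
  shows "card p \<le> 2 * card (\<Union>p)"
proof -
  let ?A = "\<lambda>R. {e \<in> p. \<exists>u v. e = {u, v} \<and> R u v \<and> (\<forall>w. {u, w} \<in> p \<longrightarrow> R u w \<longrightarrow> \<not> R v w)}"
  have sub: "\<Union>p \<subseteq> V" using graph_edges_subset[OF G] by blast
  have fin: "finite p" "finite (\<Union>p)"
    using graph_finite_edges[OF G] G sub by (auto simp: graph_def intro: finite_subset)
  have tot: "prec r a b \<or> prec r b a" if "a \<in> V" "b \<in> V" "a \<noteq> b" for a b
    using r that by (auto simp: vertex_order_def linear_order_on_def total_on_def prec_def)
  have "p \<subseteq> ?A (prec r) \<union> ?A (\<lambda>a b. prec r b a)"
  proof
    fix e assume e: "e \<in> p"
    obtain a b where ab: "a \<noteq> b" "a \<in> V" "b \<in> V" "e = {a, b}" using graphE[OF G e] .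
    obtain u v where uv: "prec r u v" "e = {u, v}"
      using tot[OF ab(2,3,1)] ab(4) by (metis insert_commute)
    show "e \<in> ?A (prec r) \<union> ?A (\<lambda>a b. prec r b a)"
    proof (rule ccontr)
      assume *: "e \<notin> ?A (prec r) \<union> ?A (\<lambda>a b. prec r b a)"
      have "\<not> (\<forall>w. {u, w} \<in> p \<longrightarrow> prec r u w \<longrightarrow> \<not> prec r v w)"
      proof
        assume "\<forall>w. {u, w} \<in> p \<longrightarrow> prec r u w \<longrightarrow> \<not> prec r v w"
        then have "e \<in> ?A (prec r)"
          using e uv by (intro CollectI conjI exI[of _ u] exI[of _ v]) auto
        then show False using * by (meson UnI1)
      qed
      then obtain w where w: "{u, w} \<in> p" "prec r u w" "prec r v w" by blast
      have "\<not> (\<forall>w. {v, w} \<in> p \<longrightarrow> prec r w v \<longrightarrow> \<not> prec r w u)"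
      proof
        assume "\<forall>w. {v, w} \<in> p \<longrightarrow> prec r w v \<longrightarrow> \<not> prec r w u"
        moreover have "e = {v, u}" using uv(2) by (simp add: insert_commute)
        ultimately have "e \<in> ?A (\<lambda>a b. prec r b a)"
          using e uv(1) by (intro CollectI conjI exI[of _ v] exI[of _ u])
        then show False using * by (meson UnI2)
      qed
      then obtain x where x: "{v, x} \<in> p" "prec r x v" "prec r x u" by blast
      \<comment> \<open>The order is \<open>x\<close>, \<open>u\<close>, \<open>v\<close>,
        \<open>w\<close>. The edge \<open>e\<close> meets both crossing edges and so plays the part
        of \<open>g\<close> in \<open>nc\<close>.\<close>
      have "cross r {x, v} {u, w}"
        unfolding cross_def using uv(1) w(2,3) x(2,3)
        by (intro exI[of _ x] exI[of _ v] exI[of _ u] exI[of _ w]) simp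
      moreover have "{x, v} \<in> p" using x(1) by (simp add: insert_commute)
      ultimately show False using nc[OF _ w(1) e, of "{x, v}"] uv(2) by simp
    qed
  qed
  then have "card p \<le> card (?A (prec r) \<union> ?A (\<lambda>a b. prec r b a))"
    by (intro card_mono) (use fin in auto)
  also have "\<dots> \<le> card (?A (prec r)) + card (?A (\<lambda>a b. prec r b a))"
    by (rule card_Un_le)
  also have "\<dots> \<le> card (\<Union>p) + card (\<Union>p)"
    by (intro add_mono card_extreme_edges_le fin) (use tot subsetD[OF sub] in metis)+
  finally show ?thesis by simp
qed

text \<open>\<open>card_page_le\<close> is applied to each page restricted to \<open>E'\<close>,
  since \<open>nc\<close> passes to subsets. The form of \<open>nc\<close> suits both kinds of
  embedding: edges joined by a third edge of their page lie in one component.\<close>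

lemma card_edges_le_sum_pages:
  assumes G: "graph V E" and r: "linear_embedding V E r P" and E': "E' \<subseteq> E"
    and nc: "\<And>p e f g. p \<in> P \<Longrightarrow> e \<in> p \<Longrightarrow> f \<in> p \<Longrightarrow> g \<in> p \<Longrightarrow> e \<inter> g \<noteq> {} \<Longrightarrow> f \<inter> g \<noteq> {} \<Longrightarrow>
              \<not> cross r e f"
  shows "card E' \<le> (\<Sum>p\<in>P. 2 * card (\<Union>(p \<inter> E')))"
proof -
  have P: "partition_on E P" and vo: "vertex_order V r"
    using r by (auto simp: linear_embedding_def)
  have "finite P" using P graph_finite_edges[OF G] by (metis finite_elements)
  have "E' = (\<Union>p\<in>P. p \<inter> E')" using E' P by (auto simp: partition_on_def)
  then have "card E' \<le> (\<Sum>p\<in>P. card (p \<inter> E'))"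
    using card_UN_le[OF \<open>finite P\<close>, of "\<lambda>p. p \<inter> E'"] by simp
  also have "\<dots> \<le> (\<Sum>p\<in>P. 2 * card (\<Union>(p \<inter> E')))"
  proof (rule sum_mono)
    fix p assume p: "p \<in> P"
    show "card (p \<inter> E') \<le> 2 * card (\<Union>(p \<inter> E'))"
      by (rule card_page_le[OF graph_subset[OF G] vo]) (use E' nc[OF p] in blast)+
  qed
  finally show ?thesis .
qed

section \<open>The two lower bounds\<close>

lemma mad_le_local_page_number:
  assumes G: "graph V E" and ne: "V \<noteq> {}"
  shows "mad V E / 4 \<le> real (local_page_number V E)"
proof -
  let ?k = "local_page_number V E"
  obtain r P where rP: "book_embedding V E r P" "k_local ?k V P"
    using local_page_number_witness[OF G] .
  have le: "linear_embedding V E r P" using rP by (simp add: book_embedding_def)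
  then have finP: "finite P"
    using graph_finite_edges[OF G] by (metis finite_elements linear_embedding_def)
  have "real (card E') \<le> real (2 * ?k) * real (card V')"
    if V': "V' \<subseteq> V" "E' \<subseteq> E" "\<And>e. e \<in> E' \<Longrightarrow> e \<subseteq> V'" for V' E'
  proof -
    have finV: "finite V'" using V' G by (auto simp: graph_def intro: finite_subset)
    have "card E' \<le> (\<Sum>p\<in>P. 2 * card (\<Union>(p \<inter> E')))"
      by (rule card_edges_le_sum_pages[OF G le V'(2)])
        (use rP(1) in \<open>auto simp: book_embedding_def\<close>)
    also have "\<dots> \<le> (\<Sum>p\<in>P. 2 * card {v \<in> V'. \<exists>e\<in>p. v \<in> e})"
      by (intro sum_mono mult_left_mono card_mono) (use finV V'(3) in auto)
    also have "\<dots> = 2 * (\<Sum>p\<in>P. card {v \<in> V'. \<exists>e\<in>p. v \<in> e})"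
      by (simp add: sum_distrib_left)
    \<comment> \<open>Incidences of vertices with pages are counted twice: summed over vertices,
      locality bounds each term by \<open>?k\<close>.\<close>
    also have "(\<Sum>p\<in>P. card {v \<in> V'. \<exists>e\<in>p. v \<in> e}) = (\<Sum>v\<in>V'. card {p \<in> P. \<exists>e\<in>p. v \<in> e})"
      by (rule sum_multicount_gen) (use finP finV in auto)
    also have "\<dots> \<le> (\<Sum>v\<in>V'. ?k)"
      by (intro sum_mono) (use rP(2) V'(1) in \<open>auto simp: k_local_def pages_at_def\<close>)
    finally have "card E' \<le> 2 * ?k * card V'" by (simp add: mult_ac)
    then show ?thesis by (metis of_nat_le_iff of_nat_mult)
  qed
  then have "mad V E \<le> 2 * real (2 * ?k)"
    by (rule mad_le[OF G ne])
  then show ?thesis by simp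
qed

lemma mad_le_union_page_number:
  assumes G: "graph V E" and ne: "V \<noteq> {}"
  shows "mad V E / 4 \<le> real (union_page_number V E)"
proof -
  let ?k = "union_page_number V E"
  obtain r P where rP: "union_embedding V E r P" "card P = ?k"
    using union_page_number_witness[OF G] .
  have le: "linear_embedding V E r P" using rP by (simp add: union_embedding_def)
  have nc: "\<not> cross r e f"
    if *: "p \<in> P" "e \<in> p" "f \<in> p" "g \<in> p" "e \<inter> g \<noteq> {}" "f \<inter> g \<noteq> {}" for p e f g
  proof -
    have "g \<in> E" using le *(1,4) by (auto simp: linear_embedding_def partition_on_def)
    then obtain a b where g: "g = {a, b}" "a \<noteq> b" using graphE[OF G] by metis
    have "same_component p e f"
    \<comment> \<open>If \<open>e\<close> and \<open>f\<close> are disjoint, the two ends of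
      \<open>g\<close> lie one in each, so \<open>g\<close> connects them.\<close>
    proof (cases "e \<inter> f = {}")
      case True
      then consider "a \<in> e" "b \<in> f" | "b \<in> e" "a \<in> f" using *(5,6) g by blast
      then show ?thesis
        using same_component_via_edge[OF *(4)] g(1) by cases (blast, metis insert_commute)
    qed (rule same_component_if_meet)
    then show ?thesis using rP(1) * unfolding union_embedding_def by blast
  qed
  have "real (card E') \<le> real (2 * ?k) * real (card V')"
    if V': "V' \<subseteq> V" "E' \<subseteq> E" "\<And>e. e \<in> E' \<Longrightarrow> e \<subseteq> V'" for V' E'
  proof -
    have finV: "finite V'" using V' G by (auto simp: graph_def intro: finite_subset)
    have "card E' \<le> (\<Sum>p\<in>P. 2 * card (\<Union>(p \<inter> E')))"
      by (rule card_edges_le_sum_pages[OF G le V'(2) nc])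
    also have "\<dots> \<le> (\<Sum>p\<in>P. 2 * card V')"
      by (intro sum_mono mult_left_mono card_mono) (use finV V'(3) in auto)
    finally have "card E' \<le> 2 * ?k * card V'" using rP(2) by (simp add: mult_ac)
    then show ?thesis by (metis of_nat_le_iff of_nat_mult)
  qed
  then have "mad V E \<le> 2 * real (2 * ?k)"
    by (rule mad_le[OF G ne])
  then show ?thesis by simp
qed

subsection \<open>Matroid union\<close>

text \<open>On a finite \<open>E\<close> these are exactly the rank functions of matroids;
  independence of \<open>X\<close> reads \<open>r X = int (card X)\<close>. Integer values allow
  ranks to be subtracted.\<close>

definition unit_submodular :: "'e set \<Rightarrow> ('e set \<Rightarrow> int) \<Rightarrow> bool" where
  "unit_submodular E r \<longleftrightarrow> r {} = 0 \<and> (\<forall>x\<in>E. r {x} \<le> 1) \<and>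
     (\<forall>X Y. X \<subseteq> Y \<longrightarrow> Y \<subseteq> E \<longrightarrow> r X \<le> r Y) \<and>
     (\<forall>X Y. X \<subseteq> E \<longrightarrow> Y \<subseteq> E \<longrightarrow> r (X \<union> Y) + r (X \<inter> Y) \<le> r X + r Y)"

text \<open>Monotonicity and submodularity need checking for single elements only: gains of single
  elements add up along an insertion of a whole set.\<close>

lemma unit_submodularI:
  assumes "finite E" "r {} = 0" "\<And>x. x \<in> E \<Longrightarrow> r {x} \<le> 1"
    and incr: "\<And>x X. x \<in> E \<Longrightarrow> X \<subseteq> E \<Longrightarrow> r X \<le> r (insert x X)"
    and dim: "\<And>x X Y. x \<in> E \<Longrightarrow> X \<subseteq> Y \<Longrightarrow> Y \<subseteq> E \<Longrightarrow> r (insert x Y) - r Y \<le> r (insert x X) - r X"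
  shows "unit_submodular E r"
proof -
  have mono: "r X \<le> r (X \<union> Z)" if "X \<subseteq> E" "Z \<subseteq> E" for X Z
    using finite_subset[OF \<open>Z \<subseteq> E\<close> assms(1)] that
  proof (induction Z rule: finite_induct)
    case (insert z Z)
    then show ?case using incr[of z "X \<union> Z"] by auto
  qed simp
  have sub: "r (Y \<union> Z) - r Y \<le> r (X \<union> Z) - r X" if "X \<subseteq> Y" "Y \<subseteq> E" "Z \<subseteq> E" for X Y Z
    using finite_subset[OF \<open>Z \<subseteq> E\<close> assms(1)] that
  proof (induction Z rule: finite_induct)
    case (insert z Z)
    have "r (insert z (Y \<union> Z)) - r (Y \<union> Z) \<le> r (insert z (X \<union> Z)) - r (X \<union> Z)"
      by (rule dim) (use insert.prems in auto)
    moreover have "r (Y \<union> Z) - r Y \<le> r (X \<union> Z) - r X"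
      by (rule insert.IH) (use insert.prems in auto)
    ultimately show ?case by simp
  qed simp
  show ?thesis
    unfolding unit_submodular_def
  proof (intro conjI ballI allI impI)
    fix X Y assume "X \<subseteq> Y" "Y \<subseteq> E"
    then show "r X \<le> r Y" using mono[of X Y] by (auto simp: Un_absorb1)
  next
    fix X Y assume "X \<subseteq> E" "Y \<subseteq> E"
    \<comment> \<open>Submodularity is the statement that adding \<open>Y\<close> gains no more over
      \<open>X\<close> than over its subset, the intersection of \<open>X\<close> and
      \<open>Y\<close>.\<close>
    then have "r (X \<union> Y) - r X \<le> r (X \<inter> Y \<union> Y) - r (X \<inter> Y)"
      by (intro sub) auto
    moreover have "X \<inter> Y \<union> Y = Y" by auto
    ultimately show "r (X \<union> Y) + r (X \<inter> Y) \<le> r X + r Y" by simp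
  qed (use assms in auto)
qed

lemma unit_submodular_mono:
  "unit_submodular E r \<Longrightarrow> X \<subseteq> Y \<Longrightarrow> Y \<subseteq> E \<Longrightarrow> r X \<le> r Y"
  by (simp add: unit_submodular_def)

lemma unit_submodular_subset:
  "unit_submodular E r \<Longrightarrow> E' \<subseteq> E \<Longrightarrow> unit_submodular E' r"
  unfolding unit_submodular_def by (meson subset_trans subsetD)

lemma unit_submodular_diminishing:
  assumes "unit_submodular E r" "X \<subseteq> Y" "Y \<subseteq> E" "e \<in> E"
  shows "r (insert e Y) - r Y \<le> r (insert e X) - r X"
proof (cases "e \<in> Y")
  case True
  then show ?thesis
    using unit_submodular_mono[OF assms(1), of X "insert e X"] assms by (auto simp: insert_absorb)
next
  case False
  have "insert e X \<union> Y = insert e Y" "insert e X \<inter> Y = X" using assms False by auto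
  moreover have "r (insert e X \<union> Y) + r (insert e X \<inter> Y) \<le> r (insert e X) + r Y"
    using assms unfolding unit_submodular_def by (meson insert_subset subset_trans)
  ultimately show ?thesis by simp
qed

text \<open>This is the rank function after contracting \<open>e\<close>. Singletons keep value at
  most 1 because the gain of \<open>x\<close> over \<open>{e}\<close> is at most its gain over the
  empty set.\<close>

lemma unit_submodular_contract:
  assumes r: "unit_submodular (insert e E) r"
  shows "unit_submodular E (\<lambda>X. r (insert e X) - r {e})"
  unfolding unit_submodular_def
proof (intro conjI ballI allI impI)
  fix x assume x: "x \<in> E"
  have "r (insert x {e}) - r {e} \<le> r (insert x {}) - r {}"
    by (rule unit_submodular_diminishing[OF r]) (use x in auto)
  also have "\<dots> \<le> 1" using r x by (auto simp: unit_submodular_def)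
  finally show "r (insert e {x}) - r {e} \<le> 1" by (simp add: insert_commute)
next
  fix X Y assume "X \<subseteq> Y" "Y \<subseteq> E"
  then show "r (insert e X) - r {e} \<le> r (insert e Y) - r {e}"
    using unit_submodular_mono[OF r, of "insert e X" "insert e Y"] by auto
next
  fix X Y assume "X \<subseteq> E" "Y \<subseteq> E"
  then have "r (insert e X \<union> insert e Y) + r (insert e X \<inter> insert e Y)
      \<le> r (insert e X) + r (insert e Y)"
    using r unfolding unit_submodular_def by (meson insert_mono)
  moreover have "insert e X \<union> insert e Y = insert e (X \<union> Y)"
    "insert e X \<inter> insert e Y = insert e (X \<inter> Y)" by auto
  ultimately show "r (insert e (X \<union> Y)) - r {e} + (r (insert e (X \<inter> Y)) - r {e})
      \<le> r (insert e X) - r {e} + (r (insert e Y) - r {e})"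
    by simp
qed simp

text \<open>The sum of the ranks minus the cardinality is submodular and, by \<open>cov\<close>,
  nonnegative. If it vanishes at two sets, it therefore vanishes at their union.\<close>

lemma tight_Union:
  fixes r :: "'i \<Rightarrow> 'e set \<Rightarrow> int"
  assumes E: "finite E" and r: "\<And>i. i \<in> I \<Longrightarrow> unit_submodular E (r i)"
    and cov: "\<And>X. X \<subseteq> E \<Longrightarrow> int (card X) \<le> (\<Sum>i\<in>I. r i X)"
    and fin: "finite S"
    and tight: "\<And>X. X \<in> S \<Longrightarrow> X \<subseteq> E \<and> (\<Sum>i\<in>I. r i X) = int (card X)"
  shows "(\<Sum>i\<in>I. r i (\<Union>S)) = int (card (\<Union>S))"
  using fin tight
proof (induction S rule: finite_induct)
  case empty
  have "(\<Sum>i\<in>I. r i {}) = (\<Sum>i\<in>I. 0)"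
    by (rule sum.cong) (use r in \<open>auto simp: unit_submodular_def\<close>)
  then show ?case by simp
next
  case (insert X S)
  let ?Y = "\<Union>S"
  have X: "X \<subseteq> E" "(\<Sum>i\<in>I. r i X) = int (card X)" using insert.prems by auto
  have Y: "?Y \<subseteq> E" "(\<Sum>i\<in>I. r i ?Y) = int (card ?Y)" using insert.prems insert.IH by auto
  have "finite X" "finite ?Y" using X Y E by (auto intro: finite_subset)
  then have c: "card X + card ?Y = card (X \<union> ?Y) + card (X \<inter> ?Y)"
    by (rule card_Un_Int)
  have "(\<Sum>i\<in>I. r i (X \<union> ?Y) + r i (X \<inter> ?Y)) \<le> (\<Sum>i\<in>I. r i X + r i ?Y)"
    by (rule sum_mono) (use r X Y in \<open>auto simp: unit_submodular_def\<close>)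
  then have "(\<Sum>i\<in>I. r i (X \<union> ?Y)) + (\<Sum>i\<in>I. r i (X \<inter> ?Y)) \<le> int (card X) + int (card ?Y)"
    using X Y by (simp add: sum.distrib)
  moreover have "int (card (X \<union> ?Y)) \<le> (\<Sum>i\<in>I. r i (X \<union> ?Y))"
    "int (card (X \<inter> ?Y)) \<le> (\<Sum>i\<in>I. r i (X \<inter> ?Y))"
    using X Y by (auto intro!: cov)
  ultimately show ?case using c by simp
qed

text \<open>The matroid union theorem. An element can be assigned to some class \<open>i\<close> and contracted there
  without violating the covering condition: otherwise every \<open>i\<close> yields a tight set whose
  \<open>i\<close>-span contains the element, and the union of these tight sets together with the element
  violates the condition.\<close>

theorem matroid_union:
  fixes r :: "'i \<Rightarrow> 'e set \<Rightarrow> int"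
  assumes "finite E" "finite I" "\<And>i. i \<in> I \<Longrightarrow> unit_submodular E (r i)"
    and "\<And>X. X \<subseteq> E \<Longrightarrow> int (card X) \<le> (\<Sum>i\<in>I. r i X)"
  shows "\<exists>f. f ` E \<subseteq> I \<and> (\<forall>i\<in>I. r i {e \<in> E. f e = i} = int (card {e \<in> E. f e = i}))"
  using assms(1,3,4)
proof (induction E arbitrary: r rule: finite_induct)
  case empty
  then show ?case by (auto simp: unit_submodular_def)
next
  case (insert e E)
  note sub = insert.prems(1) and cov = insert.prems(2)
  have subE: "unit_submodular E (r i)" if "i \<in> I" for i
    using unit_submodular_subset[OF sub[OF that]] by blast
  \<comment> \<open>The family \<open>c i\<close> contracts \<open>e\<close> in class
    \<open>i\<close> and leaves the other classes alone.\<close>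
  define c where "c i = (\<lambda>j X. if j = i then r i (insert e X) - r i {e} else r j X)" for i
  have c_sub: "unit_submodular E (c i j)" if "i \<in> I" "j \<in> I" for i j
    using unit_submodular_contract[OF sub[OF that(1)]] subE[OF that(2)]
    by (cases "j = i") (simp_all add: c_def)
  have r1: "r i {e} = 0 \<or> r i {e} = 1" if "i \<in> I" for i
  proof -
    have "r i {} \<le> r i {e}" by (rule unit_submodular_mono[OF sub[OF that]]) auto
    then show ?thesis using sub[OF that] unfolding unit_submodular_def by fastforce
  qed
  have "\<exists>i\<in>I. r i {e} = 1 \<and> (\<forall>X\<subseteq>E. int (card X) \<le> (\<Sum>j\<in>I. c i j X))"
  proof (rule ccontr)
    assume no: "\<not> ?thesis"
    have "\<exists>X. X \<subseteq> E \<and> (\<Sum>j\<in>I. r j X) = int (card X) \<and> r i (insert e X) = r i X"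
      if i: "i \<in> I" for i
    proof (cases "r i {e} = 1")
      case True
      then obtain X where X: "X \<subseteq> E" "(\<Sum>j\<in>I. c i j X) < int (card X)"
        using no i by (meson not_le)
      have "(\<Sum>j\<in>I. c i j X) = c i i X + (\<Sum>j\<in>I - {i}. c i j X)"
        using assms(2) i by (rule sum.remove)
      also have "(\<Sum>j\<in>I - {i}. c i j X) = (\<Sum>j\<in>I - {i}. r j X)"
        by (rule sum.cong) (auto simp: c_def)
      also have "c i i X = r i (insert e X) - 1" by (simp add: c_def True)
      \<comment> \<open>Integrality absorbs the 1 subtracted by the contraction. Together with
        \<open>cov\<close> at \<open>X\<close> and monotonicity this forces equality throughout:
        \<open>X\<close> is tight and \<open>e\<close> adds nothing to its rank in class
        \<open>i\<close>.\<close>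
      finally have 1: "r i (insert e X) + (\<Sum>j\<in>I - {i}. r j X) \<le> int (card X)"
        using X(2) by simp
      have 2: "(\<Sum>j\<in>I. r j X) = r i X + (\<Sum>j\<in>I - {i}. r j X)"
        using assms(2) i by (rule sum.remove)
      have "r i X \<le> r i (insert e X)"
        by (rule unit_submodular_mono[OF sub[OF i]]) (use X in auto)
      moreover have "int (card X) \<le> (\<Sum>j\<in>I. r j X)" using cov X(1) by blast
      ultimately show ?thesis using 1 2 X(1) by (intro exI[of _ X]) auto
    next
      case False
      \<comment> \<open>Here \<open>e\<close> is a loop in class \<open>i\<close>, so the empty set,
        which is tight, already spans it.\<close>
      then have "r i {e} = 0" "r i {} = 0"
        using r1[OF i] sub[OF i] by (auto simp: unit_submodular_def)
      moreover have "(\<Sum>j\<in>I. r j {}) = (\<Sum>j\<in>I. 0)"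
        by (rule sum.cong) (use sub in \<open>auto simp: unit_submodular_def\<close>)
      ultimately show ?thesis by (intro exI[of _ "{}"]) auto
    qed
    then obtain T where T: "\<And>i. i \<in> I \<Longrightarrow> T i \<subseteq> E"
      "\<And>i. i \<in> I \<Longrightarrow> (\<Sum>j\<in>I. r j (T i)) = int (card (T i))"
      "\<And>i. i \<in> I \<Longrightarrow> r i (insert e (T i)) = r i (T i)"
      by metis
    let ?U = "\<Union>(T ` I)"
    have U: "?U \<subseteq> E" using T(1) by blast
    have tight: "(\<Sum>j\<in>I. r j ?U) = int (card ?U)"
      by (rule tight_Union[OF insert.hyps(1) subE]) (use cov T assms(2) in \<open>auto simp: subset_insertI2\<close>)
    have eq: "r i (insert e ?U) \<le> r i ?U" if i: "i \<in> I" for i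
      using unit_submodular_diminishing[OF sub[OF i], of "T i" ?U e] T(3)[OF i] U i by auto
    \<comment> \<open>By \<open>eq\<close> the element \<open>e\<close> raises no rank over the
      tight set \<open>?U\<close>, yet it raises the cardinality by one.\<close>
    have "int (card (insert e ?U)) \<le> (\<Sum>j\<in>I. r j (insert e ?U))"
      by (rule cov) (use U in auto)
    also have "\<dots> \<le> (\<Sum>j\<in>I. r j ?U)" by (rule sum_mono) (rule eq)
    finally have "card (insert e ?U) \<le> card ?U" using tight by simp
    moreover have "e \<notin> ?U" "finite ?U"
      using U insert.hyps by (auto intro: finite_subset)
    ultimately show False by simp
  qed
  then obtain i where i: "i \<in> I" "r i {e} = 1" "\<And>X. X \<subseteq> E \<Longrightarrow> int (card X) \<le> (\<Sum>j\<in>I. c i j X)"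
    by blast
  obtain f where f: "f ` E \<subseteq> I"
    "\<forall>j\<in>I. c i j {x \<in> E. f x = j} = int (card {x \<in> E. f x = j})"
    using insert.IH[OF c_sub[OF i(1)] i(3)] by blast
  show ?case
  proof (intro exI[of _ "f(e := i)"] conjI ballI)
    show "(f(e := i)) ` insert e E \<subseteq> I" using f(1) i(1) by auto
    fix j assume j: "j \<in> I"
    show "r j {x \<in> insert e E. (f(e := i)) x = j} = int (card {x \<in> insert e E. (f(e := i)) x = j})"
    proof (cases "j = i")
      case True
      have "{x \<in> insert e E. (f(e := i)) x = j} = insert e {x \<in> E. f x = i}"
        using True insert.hyps(2) by auto
      moreover have "card (insert e {x \<in> E. f x = i}) = Suc (card {x \<in> E. f x = i})"
        using insert.hyps by simp
      \<comment> \<open>The unit \<open>r i {e}\<close> subtracted by the contraction accounts for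
        the element \<open>e\<close> that joins this fibre.\<close>
      ultimately show ?thesis
        using bspec[OF f(2) i(1)] True i(2) by (simp add: c_def)
    next
      case False
      then have "{x \<in> insert e E. (f(e := i)) x = j} = {x \<in> E. f x = j}"
        using insert.hyps(2) by auto
      then show ?thesis using bspec[OF f(2) j] False by (simp add: c_def)
    qed
  qed
qed

subsection \<open>Orientations of small outdegree\<close>

text \<open>Hakimi's theorem, as the matroid union of \<open>d\<close> rank-one matroids per vertex.\<close>

lemma orientation_exists:
  assumes G: "graph V E" and ne: "V \<noteq> {}" and d: "mad V E / 2 \<le> real d"
  shows "\<exists>t. (\<forall>e\<in>E. t e \<in> e) \<and> (\<forall>v. card {e \<in> E. t e = v} \<le> d)"
proof -
  \<comment> \<open>Class \<open>(v, i)\<close> has rank 1 on a set containing an edge at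
    \<open>v\<close>, and rank 0 otherwise. Its independent sets are thus empty or a single edge at
    \<open>v\<close>; assigning an edge to \<open>(v, i)\<close> directs it out of
    \<open>v\<close>.\<close>
  define r :: "'a \<times> nat \<Rightarrow> 'a set set \<Rightarrow> int" where "r = (\<lambda>(v, i) X. of_bool (v \<in> \<Union>X))"
  have finV: "finite V" and finE: "finite E"
    using G graph_finite_edges by (auto simp: graph_def)
  have sub: "unit_submodular E (r p)" for p
    by (cases p) (rule unit_submodularI, auto simp: r_def finE)
  have cov: "int (card X) \<le> (\<Sum>p\<in>V \<times> {..<d}. r p X)" if X: "X \<subseteq> E" for X
  proof -
    have UX: "\<Union>X \<subseteq> V" using X graph_edges_subset[OF G] by blast
    have "(\<Sum>p\<in>V \<times> {..<d}. r p X) = (\<Sum>v\<in>V. \<Sum>i<d. of_bool (v \<in> \<Union>X))"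
      unfolding r_def sum.cartesian_product by (rule sum.cong) auto
    also have "\<dots> = int d * (\<Sum>v\<in>V. of_bool (v \<in> \<Union>X))"
      by (simp add: sum_distrib_left)
    also have "(\<Sum>v\<in>V. of_bool (v \<in> \<Union>X)) = int (card (\<Union>X))"
      using UX finV by (simp add: sum.If_cases of_bool_def Int_absorb1 del: Union_iff)
    finally have eq: "(\<Sum>p\<in>V \<times> {..<d}. r p X) = int (d * card (\<Union>X))" by simp
    have "real (card X) \<le> mad V E / 2 * real (card (\<Union>X))"
      by (rule card_edges_le_mad[OF G ne UX X]) blast
    also have "\<dots> \<le> real d * real (card (\<Union>X))" by (rule mult_right_mono[OF d]) simp
    finally have "card X \<le> d * card (\<Union>X)" by (metis of_nat_le_iff of_nat_mult)
    then show ?thesis unfolding eq by (simp only: of_nat_le_iff)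
  qed
  obtain f where f: "f ` E \<subseteq> V \<times> {..<d}"
    "\<forall>p\<in>V \<times> {..<d}. r p {e \<in> E. f e = p} = int (card {e \<in> E. f e = p})"
    using matroid_union[OF finE _ sub cov] finV by blast
  have le1: "card {e \<in> E. f e = p} \<le> 1" if "p \<in> V \<times> {..<d}" for p
  proof -
    have "r p {e \<in> E. f e = p} \<le> 1" by (cases p) (simp add: r_def)
    then show ?thesis using bspec[OF f(2) that] by linarith
  qed
  show ?thesis
  proof (intro exI[of _ "\<lambda>e. fst (f e)"] conjI ballI allI)
    fix e assume e: "e \<in> E"
    define p where "p = f e"
    have p: "p \<in> V \<times> {..<d}" using f(1) e by (auto simp: p_def)
    have "e \<in> {x \<in> E. f x = p}" using e by (simp add: p_def)
    then have pos: "0 < card {x \<in> E. f x = p}" using finE by (auto simp: card_gt_0_iff)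
    then have "card {x \<in> E. f x = p} = 1" using le1[OF p] by simp
    then obtain x where "{x \<in> E. f x = p} = {x}" by (auto simp: card_1_singleton_iff)
    then have eq: "{x \<in> E. f x = p} = {e}" using \<open>e \<in> {x \<in> E. f x = p}\<close> by auto
    \<comment> \<open>Independence of the fibre \<open>{e}\<close> says that the vertex of its class
      is an end of \<open>e\<close>.\<close>
    have "r p {e} = 1" using bspec[OF f(2) p] eq by simp
    then show "fst (f e) \<in> e" by (cases p) (auto simp: r_def p_def split: if_splits)
  next
    fix v
    show "card {e \<in> E. fst (f e) = v} \<le> d"
    proof (cases "v \<in> V")
      case True
      have "{e \<in> E. fst (f e) = v} \<subseteq> (\<Union>i<d. {e \<in> E. f e = (v, i)})"
        using f(1) by force
      then have "card {e \<in> E. fst (f e) = v} \<le> card (\<Union>i<d. {e \<in> E. f e = (v, i)})"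
        by (intro card_mono) (use finE in auto)
      also have "\<dots> \<le> (\<Sum>i<d. card {e \<in> E. f e = (v, i)})"
        by (rule card_UN_le) simp
      also have "\<dots> \<le> (\<Sum>i<d. 1)"
        by (rule sum_mono) (use le1 True in auto)
      finally show ?thesis by simp
    next
      case False
      then have "{e \<in> E. fst (f e) = v} = {}" using f(1) by force
      then show ?thesis by (simp only: card.empty le0)
    qed
  qed
qed

text \<open>Direct \<open>e\<close> from \<open>t e\<close> to \<open>h e\<close> and collect the
  edges with the same head into a star. A vertex meets its own star of incoming edges and the stars
  at the heads of its at most \<open>d\<close> outgoing edges.\<close>

lemma local_star_arboricity_le_orientation:
  assumes G: "graph V E" and t: "\<forall>e\<in>E. t e \<in> e" "\<forall>v. card {e \<in> E. t e = v} \<le> d"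
  shows "local_star_arboricity V E \<le> d + 1"
proof -
  have finE: "finite E" using graph_finite_edges[OF G] .
  have "\<exists>w. e = {t e, w}" if "e \<in> E" for e
    using graphE[OF G that] t(1) that by (metis insertE insert_commute singletonD)
  then obtain h where h: "\<And>e. e \<in> E \<Longrightarrow> e = {t e, h e}" by metis
  define Q where "Q = (\<lambda>i. {e \<in> E. h e = i}) ` (h ` E)"
  have "partition_on E Q" unfolding Q_def by (rule fibres_partition)
  moreover have "\<forall>S\<in>Q. is_star S"
  proof
    fix S assume "S \<in> Q"
    then obtain i where i: "i \<in> h ` E" "S = {e \<in> E. h e = i}" unfolding Q_def by blast
    then have "i \<in> e" if "e \<in> S" for e using h[of e] that by auto
    then show "is_star S" using i unfolding is_star_def by blast
  qed
  moreover have "\<forall>v\<in>V. card {S \<in> Q. \<exists>e\<in>S. v \<in> e} \<le> d + 1"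
  proof
    fix v
    let ?W = "insert v (h ` {e \<in> E. t e = v})"
    have "{S \<in> Q. \<exists>e\<in>S. v \<in> e} \<subseteq> (\<lambda>i. {e \<in> E. h e = i}) ` ?W"
    proof
      fix S assume "S \<in> {S \<in> Q. \<exists>e\<in>S. v \<in> e}"
      then obtain i e where ie: "S = {e \<in> E. h e = i}" "e \<in> E" "h e = i" "v \<in> e"
        unfolding Q_def by blast
      then have "v = t e \<or> v = i" using h[of e] by auto
      then have "i \<in> ?W" using ie by auto
      then show "S \<in> (\<lambda>i. {e \<in> E. h e = i}) ` ?W" using ie(1) by blast
    qed
    then have "card {S \<in> Q. \<exists>e\<in>S. v \<in> e} \<le> card ?W"
      by (rule surj_card_le[rotated]) (use finE in auto)
    also have "\<dots> \<le> Suc (card (h ` {e \<in> E. t e = v}))"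
      using finE by (simp add: card_insert_if)
    also have "card (h ` {e \<in> E. t e = v}) \<le> card {e \<in> E. t e = v}"
      using finE by (intro card_image_le) simp
    also have "\<dots> \<le> d" using t(2) by blast
    finally show "card {S \<in> Q. \<exists>e\<in>S. v \<in> e} \<le> d + 1" by simp
  qed
  ultimately show ?thesis
    unfolding local_star_arboricity_def by (intro Least_le exI[of _ Q] conjI)
qed

lemma local_page_number_le_mad:
  assumes G: "graph V E" and ne: "V \<noteq> {}"
  shows "real (local_page_number V E) \<le> mad V E / 2 + 2"
proof -
  \<comment> \<open>Rounding up costs at most 1 and the star of incoming edges costs 1 more, which
    makes the 2 in the bound.\<close>
  define d where "d = nat \<lceil>mad V E / 2\<rceil>"
  have d: "mad V E / 2 \<le> real d" "real d \<le> mad V E / 2 + 1"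
    using mad_nonneg[OF assms] unfolding d_def by linarith+
  obtain t where "\<forall>e\<in>E. t e \<in> e" "\<forall>v. card {e \<in> E. t e = v} \<le> d"
    using orientation_exists[OF assms d(1)] by blast
  then have "local_star_arboricity V E \<le> d + 1"
    by (rule local_star_arboricity_le_orientation[OF G])
  then have "local_page_number V E \<le> d + 1"
    using local_page_number_le_local_star_arboricity[OF G] by simp
  then show ?thesis using d(2) by linarith
qed

subsection \<open>The rank of the graphic matroid\<close>

definition conn :: "'a set set \<Rightarrow> 'a \<Rightarrow> 'a \<Rightarrow> bool" where
  "conn X = (\<lambda>a b. {a, b} \<in> X)\<^sup>*\<^sup>*"

definition component :: "'a set \<Rightarrow> 'a set set \<Rightarrow> 'a \<Rightarrow> 'a set" where
  "component V X v = {w \<in> V. conn X v w}"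

text \<open>The size of a largest forest in \<open>X\<close>. Vertices of \<open>V\<close> that
  \<open>X\<close> does not cover count as components of their own.\<close>

definition graphic_rank :: "'a set \<Rightarrow> 'a set set \<Rightarrow> int" where
  "graphic_rank V X = int (card V) - int (card (component V X ` V))"

lemma conn_refl [simp]: "conn X a a"
  by (simp add: conn_def)

lemma conn_trans: "conn X a b \<Longrightarrow> conn X b c \<Longrightarrow> conn X a c"
  by (simp add: conn_def)

lemma conn_sym:
  assumes "conn X a b" shows "conn X b a"
proof -
  have "symp (\<lambda>a b. {a, b} \<in> X)" by (rule sympI) (simp add: insert_commute)
  then have "symp (conn X)" unfolding conn_def by (rule symp_rtranclp)
  then show ?thesis using assms by (rule sympD)
qed

lemma conn_edge: "{a, b} \<in> X \<Longrightarrow> conn X a b"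
  by (auto simp: conn_def)

lemma conn_mono:
  assumes "X \<subseteq> Y" "conn X a b" shows "conn Y a b"
  using rtranclp_mono[of "\<lambda>a b. {a, b} \<in> X" "\<lambda>a b. {a, b} \<in> Y"] assms
  by (auto simp: conn_def le_fun_def)

text \<open>A walk can be shortened until it uses the new edge at most once, in one of the two
  directions.\<close>

lemma conn_insert:
  "conn (insert {u, v} X) a b \<longleftrightarrow>
     conn X a b \<or> (conn X a u \<and> conn X v b) \<or> (conn X a v \<and> conn X u b)"
proof
  assume "conn (insert {u, v} X) a b"
  then show "conn X a b \<or> (conn X a u \<and> conn X v b) \<or> (conn X a v \<and> conn X u b)"
    unfolding conn_def[of "insert {u, v} X"]
  proof (induction rule: rtranclp_induct)
    case (step y z)
    from step.hyps(2) consider "conn X y z" | "y = u" "z = v" | "y = v" "z = u"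
      using conn_edge[of y z X] by (auto simp: doubleton_eq_iff)
    then show ?case
      using step.IH by cases (meson conn_trans, meson conn_refl conn_trans conn_sym, meson conn_refl conn_trans conn_sym)
  qed simp
next
  have uv: "conn (insert {u, v} X) u v" by (rule conn_edge) simp
  assume "conn X a b \<or> (conn X a u \<and> conn X v b) \<or> (conn X a v \<and> conn X u b)"
  then show "conn (insert {u, v} X) a b"
    using uv conn_sym[OF uv] conn_mono[of X "insert {u, v} X"] by (meson conn_trans subset_insertI)
qed

lemma component_eq_iff:
  assumes "a \<in> V" "b \<in> V"
  shows "component V X a = component V X b \<longleftrightarrow> conn X a b"
proof
  assume "component V X a = component V X b"
  then have "b \<in> component V X a" using assms by (simp add: component_def)
  then show "conn X a b" by (simp add: component_def)
next
  assume "conn X a b"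
  then have "conn X a w \<longleftrightarrow> conn X b w" for w by (meson conn_trans conn_sym)
  then show "component V X a = component V X b" by (simp add: component_def)
qed

text \<open>An edge between two components merges them; an edge within one changes nothing. The
  matroid properties of the rank are all read off from this.\<close>

lemma graphic_rank_insert:
  assumes fin: "finite V" and u: "u \<in> V" and v: "v \<in> V"
  shows "graphic_rank V (insert {u, v} X) = graphic_rank V X + of_bool (\<not> conn X u v)"
proof (cases "conn X u v")
  case True
  then have "conn (insert {u, v} X) a b \<longleftrightarrow> conn X a b" for a b
    unfolding conn_insert by (meson conn_trans conn_sym)
  then have "component V (insert {u, v} X) = component V X"
    by (simp add: component_def fun_eq_iff)
  then show ?thesis using True by (simp add: graphic_rank_def)
next
  case False
  let ?Y = "insert {u, v} X"
  let ?c = "component V X"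
  \<comment> \<open>The vertices outside the two components to be merged; their components stay as
    they are.\<close>
  define W where "W = {a \<in> V. \<not> conn X a u \<and> \<not> conn X a v}"
  have eqW: "component V ?Y a = ?c a" if "a \<in> W" for a
    using that by (auto simp: component_def conn_insert W_def)
  have eqU: "component V ?Y a = ?c u \<union> ?c v" if "a \<in> V - W" for a
  proof -
    have "conn X a u \<or> conn X a v" using that by (auto simp: W_def)
    then have "conn ?Y a b \<longleftrightarrow> conn X u b \<or> conn X v b" for b
      unfolding conn_insert by (meson conn_trans conn_sym)
    then show ?thesis by (auto simp: component_def)
  qed
  have uvW: "u \<in> V - W" "v \<in> V - W" using u v by (auto simp: W_def)
  have V: "V = W \<union> (V - W)" by (auto simp: W_def)
  have old: "?c ` V = insert (?c u) (insert (?c v) (?c ` W))"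
  proof -
    have "?c a = ?c u \<or> ?c a = ?c v" if "a \<in> V - W" for a
      using that u v by (auto simp: component_eq_iff W_def)
    then have "?c ` (V - W) = {?c u, ?c v}" using uvW by auto
    then show ?thesis by (subst V) (simp only: image_Un, auto)
  qed
  have new: "component V ?Y ` V = insert (?c u \<union> ?c v) (?c ` W)"
  proof -
    have "component V ?Y ` (V - W) = {?c u \<union> ?c v}" using eqU uvW by auto
    moreover have "component V ?Y ` W = ?c ` W" using eqW by auto
    ultimately show ?thesis by (subst V) (simp only: image_Un, auto)
  qed
  have uin: "u \<in> ?c u" "v \<in> ?c v" using u v by (auto simp: component_def)
  have nin: "u \<notin> C \<and> v \<notin> C" if "C \<in> ?c ` W" for C
    using that by (auto simp: component_def W_def)
  \<comment> \<open>These inequalities ensure that no components coincide in the count: two besides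
    those of \<open>W\<close> before, one after.\<close>
  have "?c u \<notin> ?c ` W" "?c v \<notin> ?c ` W" "?c u \<union> ?c v \<notin> ?c ` W"
    using uin nin by blast+
  moreover have "?c u \<noteq> ?c v" using False u v by (simp add: component_eq_iff)
  moreover have "finite (?c ` W)" using fin by (auto simp: W_def)
  ultimately have "card (?c ` V) = card (?c ` W) + 2" "card (component V ?Y ` V) = card (?c ` W) + 1"
    unfolding old new by auto
  then show ?thesis using False by (simp add: graphic_rank_def)
qed

lemma graphic_rank_empty:
  assumes "finite V" shows "graphic_rank V {} = 0"
proof -
  have "conn {} a b \<longleftrightarrow> a = b" for a b :: 'a
    unfolding conn_def using rtranclp.cases by fastforce
  then have "component V {} a = {a}" if "a \<in> V" for a
    using that by (auto simp: component_def)
  then have "inj_on (component V {}) V" by (auto simp: inj_on_def)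
  then show ?thesis by (simp add: graphic_rank_def card_image)
qed

text \<open>The gain of an edge is 1 or 0 according to whether its ends are still unconnected, and
  adding edges only creates connections.\<close>

lemma unit_submodular_graphic_rank:
  assumes "graph V E"
  shows "unit_submodular E (graphic_rank V)"
proof (rule unit_submodularI)
  have fin: "finite V" using assms by (simp add: graph_def)
  show "finite E" using graph_finite_edges[OF assms] .
  show "graphic_rank V {} = 0" by (rule graphic_rank_empty[OF fin])
  fix x assume x: "x \<in> E"
  obtain u v where uv: "u \<in> V" "v \<in> V" "x = {u, v}" using graphE[OF assms x] .
  show "graphic_rank V {x} \<le> 1"
    using graphic_rank_insert[OF fin uv(1,2), of "{}"] graphic_rank_empty[OF fin]
    by (simp add: uv(3))
  show "graphic_rank V X \<le> graphic_rank V (insert x X)" for X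
    using graphic_rank_insert[OF fin uv(1,2)] by (simp add: uv(3))
  show "graphic_rank V (insert x Y) - graphic_rank V Y
      \<le> graphic_rank V (insert x X) - graphic_rank V X" if "X \<subseteq> Y" for X Y
    using graphic_rank_insert[OF fin uv(1,2)] conn_mono[OF that, of u v] by (auto simp: uv(3))
qed

lemma graphic_rank_le_card:
  assumes "graph V F"
  shows "graphic_rank V F \<le> int (card F)"
  using graph_finite_edges[OF assms] assms
proof (induction F rule: finite_induct)
  case empty
  then show ?case by (simp add: graphic_rank_empty graph_def)
next
  case (insert e F)
  have "e \<in> insert e F" by simp
  from graphE[OF insert.prems this]
  obtain u v where uv: "u \<in> V" "v \<in> V" "e = {u, v}" .
  have "graphic_rank V F \<le> int (card F)"
    using insert.IH insert.prems graph_subset by blast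
  moreover have "graphic_rank V (insert e F) \<le> graphic_rank V F + 1"
    using graphic_rank_insert[OF _ uv(1,2)] insert.prems by (simp add: uv(3) graph_def)
  ultimately show ?case using insert.hyps by simp
qed

text \<open>Every vertex not covered by \<open>F\<close> is a component of its own, and a covered
  vertex \<open>u\<close> gives one component more. This extra component makes the inequality
  strict.\<close>

lemma graphic_rank_less_card_vertices:
  assumes G: "graph V F" and "F \<noteq> {}"
  shows "graphic_rank V F < int (card (\<Union>F))"
proof -
  have sub: "\<Union>F \<subseteq> V" using graph_edges_subset[OF G] by blast
  have fin: "finite V" using G by (simp add: graph_def)
  obtain e where e: "e \<in> F" using assms(2) by blast
  obtain u v where uv: "u \<in> V" "v \<in> V" "e = {u, v}" using graphE[OF G e] .
  have single: "a = b" if "a \<notin> \<Union>F" "conn F a b" for a b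
    using that(2,1) unfolding conn_def by (cases rule: converse_rtranclpE) auto
  have inj: "inj_on (component V F) (insert u (V - \<Union>F))"
  proof (rule inj_onI)
    fix a b assume *: "a \<in> insert u (V - \<Union>F)" "b \<in> insert u (V - \<Union>F)"
      "component V F a = component V F b"
    then have ab: "conn F a b" using uv(1) component_eq_iff[of a V b F] by blast
    then show "a = b" using * single[of a b] single[of b a] conn_sym[OF ab] by blast
  qed
  have "u \<in> \<Union>F" using e uv(3) by blast
  then have "card V - card (\<Union>F) + 1 = card (insert u (V - \<Union>F))"
    using fin sub by (simp add: card_Diff_subset finite_subset)
  also have "\<dots> = card (component V F ` insert u (V - \<Union>F))"
    by (rule card_image[OF inj, symmetric])
  also have "\<dots> \<le> card (component V F ` V)"
    by (rule card_mono) (use fin uv(1) in auto)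
  finally have "card V - card (\<Union>F) + 1 \<le> card (component V F ` V)" .
  moreover have "card (\<Union>F) \<le> card V" using card_mono[OF fin sub] .
  ultimately show ?thesis unfolding graphic_rank_def by linarith
qed

subsection \<open>Forests\<close>

inductive forest :: "'a set set \<Rightarrow> bool" where
  forest_empty: "forest {}"
| forest_leaf: "forest F \<Longrightarrow> u \<notin> \<Union>F \<Longrightarrow> u \<noteq> v \<Longrightarrow> forest (insert {u, v} F)"

text \<open>Otherwise every covered vertex has degree at least 2, so there are at least as many
  edges as covered vertices, while the rank is smaller than the number of covered vertices.\<close>

lemma independent_has_leaf:
  assumes G: "graph V F" and ne: "F \<noteq> {}" and ind: "graphic_rank V F = int (card F)"
  shows "\<exists>u e. e \<in> F \<and> u \<in> e \<and> u \<notin> \<Union>(F - {e})"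
proof (rule ccontr)
  assume no: "\<not> ?thesis"
  have sub: "\<Union>F \<subseteq> V" using graph_edges_subset[OF G] by blast
  have fin: "finite F" "finite (\<Union>F)"
    using graph_finite_edges[OF G] G sub by (auto simp: graph_def intro: finite_subset)
  have deg: "2 \<le> card {e \<in> F. u \<in> e}" if u: "u \<in> \<Union>F" for u
  proof -
    obtain e where e: "e \<in> F" "u \<in> e" using u by blast
    then obtain f where f: "f \<in> F" "f \<noteq> e" "u \<in> f" using no by blast
    have "card {e, f} \<le> card {e \<in> F. u \<in> e}" by (rule card_mono) (use e f fin in auto)
    then show ?thesis using f(2) by simp
  qed
  have "2 * card (\<Union>F) = (\<Sum>u\<in>\<Union>F. 2)" by simp
  also have "\<dots> \<le> (\<Sum>u\<in>\<Union>F. card {e \<in> F. u \<in> e})" by (rule sum_mono[OF deg])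
  also have "\<dots> = 2 * card F"
  proof (rule sum_multicount[OF fin(2,1)], rule ballI)
    fix e assume e: "e \<in> F"
    obtain u v where uv: "u \<noteq> v" "e = {u, v}" using graphE[OF G e] .
    have "{i \<in> \<Union>F. i \<in> e} = {u, v}" using e uv by blast
    then show "card {i \<in> \<Union>F. i \<in> e} = 2" using uv(1) by simp
  qed
  finally have "card (\<Union>F) \<le> card F" by simp
  then show False using graphic_rank_less_card_vertices[OF G ne] ind by simp
qed

text \<open>Remove a leaf edge and induct. The rest stays independent: its rank drops by at most 1
  and cannot exceed its cardinality.\<close>

lemma forest_if_independent:
  assumes "graph V F" "graphic_rank V F = int (card F)"
  shows "forest F"
  using assms
proof (induction "card F" arbitrary: F)
  case 0
  then have "F = {}" using graph_finite_edges[of V F] by auto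
  then show ?case by (simp add: forest_empty)
next
  case (Suc n)
  note G = Suc.prems(1)
  have fin: "finite V" "finite F" using G graph_finite_edges by (auto simp: graph_def)
  have "F \<noteq> {}" using Suc.hyps(2) by auto
  then obtain u e where ue: "e \<in> F" "u \<in> e" "u \<notin> \<Union>(F - {e})"
    using independent_has_leaf[OF G _ Suc.prems(2)] by blast
  obtain a b where ab: "a \<noteq> b" "a \<in> V" "b \<in> V" "e = {a, b}" using graphE[OF G ue(1)] .
  obtain v where v: "u \<noteq> v" "e = {u, v}"
    using ab ue(2) by (metis insertE insert_commute singletonD)
  have F: "F = insert {a, b} (F - {e})" using ue(1) ab(4) by blast
  have G': "graph V (F - {e})" using graph_subset[OF G] by blast
  have c: "card (F - {e}) = n" using Suc.hyps(2) ue(1) by simp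
  have "graphic_rank V F \<le> graphic_rank V (F - {e}) + 1"
    using graphic_rank_insert[OF fin(1) ab(2,3), of "F - {e}"] F by simp
  then have "graphic_rank V (F - {e}) = int (card (F - {e}))"
    using graphic_rank_le_card[OF G'] Suc.prems(2) Suc.hyps(2) c by simp
  then have "forest (F - {e})" using Suc.hyps(1)[OF c[symmetric] G'] by blast
  then have "forest (insert {u, v} (F - {e}))"
    using ue(3) v(1) by (rule forest_leaf)
  then show ?case using F ab(4) v(2) by simp
qed

text \<open>\<open>C\<close> holds the centres. Each edge joins a centre to a vertex outside
  \<open>C\<close> that lies on no other edge, so from the centre \<open>y\<close> of
  \<open>e\<close> only \<open>y\<close> and its neighbours can be reached.\<close>

lemma star_forestI:
  assumes bip: "\<And>e. e \<in> F \<Longrightarrow> \<exists>x y. e = {x, y} \<and> x \<notin> C \<and> y \<in> C"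
    and uniq: "\<And>e f x. e \<in> F \<Longrightarrow> f \<in> F \<Longrightarrow> x \<in> e \<Longrightarrow> x \<in> f \<Longrightarrow> x \<notin> C \<Longrightarrow> e = f"
  shows "star_forest F"
  unfolding star_forest_def
proof
  fix e assume e: "e \<in> F"
  obtain x y where xy: "e = {x, y}" "x \<notin> C" "y \<in> C" using bip[OF e] by blast
  have notC: "w \<notin> C" if "{w, y} \<in> F" for w
    using bip[OF that] xy(3) by (auto simp: doubleton_eq_iff)
  have reach: "w = y \<or> {w, y} \<in> F" if "(\<lambda>a b. {a, b} \<in> F)\<^sup>*\<^sup>* u w" "u \<in> e" for u w
    using that
  proof (induction rule: rtranclp_induct)
    case base
    then show ?case using e xy(1) by auto
  next
    case (step w z)
    then consider "w = y" | "{w, y} \<in> F" by blast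
    then show ?case
    proof cases
      case 1
      then show ?thesis using step.hyps(2) by (simp add: insert_commute)
    next
      case 2
      then have "{w, z} = {w, y}"
        using uniq[OF step.hyps(2) 2, of w] notC[OF 2] by simp
      then show ?thesis using 2 by (auto simp: doubleton_eq_iff)
    qed
  qed
  have "y \<in> f" if f: "f \<in> F" "same_component F e f" for f
  proof -
    obtain u w where "u \<in> e" "w \<in> f" "(\<lambda>a b. {a, b} \<in> F)\<^sup>*\<^sup>* u w"
      using f(2) unfolding same_component_def by blast
    then consider "w = y" | "{w, y} \<in> F" using reach by blast
    then show ?thesis
    proof cases
      case 2
      then have "f = {w, y}" using uniq[OF f(1) 2 \<open>w \<in> f\<close>] notC by simp
      then show ?thesis by simp
    qed (use \<open>w \<in> f\<close> in simp)
  qed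
  moreover have "same_component F e e" by (rule same_component_if_meet) (simp add: xy(1))
  ultimately show "is_star {f \<in> F. same_component F e f}"
    using e unfolding is_star_def by blast
qed

text \<open>Root each component: \<open>t e\<close> is the end of \<open>e\<close> farther from the root, \<open>q\<close> the parity of the
  depth.\<close>

lemma forest_rooting:
  assumes "forest F"
  shows "\<exists>t q. inj_on t F \<and> (\<forall>e\<in>F. t e \<in> e \<and> (\<exists>x y. e = {x, y} \<and> q x \<noteq> (q y :: bool)))"
  using assms
proof (induction rule: forest.induct)
  case forest_empty
  show ?case by simp
next
  case (forest_leaf F u v)
  from forest_leaf.IH obtain t q where tq1: "inj_on t F"
    and "\<forall>e\<in>F. t e \<in> e \<and> (\<exists>x y. e = {x, y} \<and> q x \<noteq> (q y :: bool))" by (elim exE conjE)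
  then have tq2: "t e \<in> e" and tq3: "\<exists>x y. e = {x, y} \<and> q x \<noteq> q y" if "e \<in> F" for e
    using that by simp_all
  let ?e = "{u, v}"
  let ?t = "t(?e := u)" and ?q = "q(u := \<not> q v)"
  have nF: "?e \<notin> F" using forest_leaf.hyps(2) by blast
  have inj: "inj_on ?t (insert ?e F)"
  proof -
    have "u \<notin> t ` F" using tq2 forest_leaf.hyps(2) by blast
    moreover have "?t ` F = t ` F" using nF by (auto simp: image_def)
    moreover have "inj_on ?t F" using tq1 nF by (simp add: inj_on_def)
    ultimately show ?thesis using nF by (simp add: inj_on_insert)
  qed
  have step: "?t e \<in> e \<and> (\<exists>x y. e = {x, y} \<and> ?q x \<noteq> ?q y)" if "e \<in> insert ?e F" for e
  proof (cases "e = ?e")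
    case True
    then show ?thesis using forest_leaf.hyps(3) by (intro conjI exI[of _ u] exI[of _ v]) simp_all
  next
    case False
    then have e: "e \<in> F" using that by simp
    obtain x y where xy: "e = {x, y}" "q x \<noteq> q y" using tq3[OF e] by (elim exE conjE)
    then have "x \<noteq> u" "y \<noteq> u" using e forest_leaf.hyps(2) by blast+
    then have "?q x \<noteq> ?q y" using xy(2) by simp
    then show ?thesis using xy(1) tq2[OF e] False by (intro conjI exI[of _ x] exI[of _ y]) simp_all
  qed
  show ?case
    by (intro exI[of _ ?t] exI[of _ ?q] conjI[OF inj] ballI) (rule step)
qed

text \<open>Edges are coloured by the depth parity of their far end \<open>t e\<close>. In class
  \<open>b\<close> the vertices of the other parity are the centres; a vertex of parity
  \<open>b\<close> is the far end of each of its edges there, hence of only one.\<close>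

lemma forest_two_star_forests:
  assumes "forest F"
  shows "\<exists>h :: 'a set \<Rightarrow> bool. \<forall>b. star_forest {e \<in> F. h e = b}"
proof -
  obtain t q where tq: "inj_on t F" "\<And>e. e \<in> F \<Longrightarrow> t e \<in> e"
    "\<And>e. e \<in> F \<Longrightarrow> \<exists>x y. e = {x, y} \<and> q x \<noteq> (q y :: bool)"
    using forest_rooting[OF assms] by metis
  have tail: "x = t e" if "e \<in> F" "x \<in> e" "q x = q (t e)" for e x
    using tq(2,3)[OF that(1)] that(2,3) by auto
  have "star_forest {e \<in> F. q (t e) = b}" for b
  proof (rule star_forestI[where C = "{x. q x \<noteq> b}"])
    fix e assume "e \<in> {e \<in> F. q (t e) = b}"
    then obtain x y where "e = {x, y}" "q x \<noteq> q y" using tq(3) by blast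
    then show "\<exists>x y. e = {x, y} \<and> x \<notin> {x. q x \<noteq> b} \<and> y \<in> {x. q x \<noteq> b}"
      by (cases "q x = b") (auto simp: insert_commute)
  next
    fix e f x
    assume *: "e \<in> {e \<in> F. q (t e) = b}" "f \<in> {e \<in> F. q (t e) = b}" "x \<in> e" "x \<in> f"
      "x \<notin> {x. q x \<noteq> b}"
    then have "x = t e" "x = t f" using tail[of e x] tail[of f x] by auto
    then show "e = f" using tq(1) * by (auto dest: inj_onD)
  qed
  then show ?thesis by (intro exI[of _ "\<lambda>e. q (t e)"]) blast
qed

text \<open>A new leaf is placed so close to its neighbour that no vertex lies between them.\<close>

lemma forest_order:
  assumes "forest F" "finite V" "\<Union>F \<subseteq> V"
  shows "\<exists>g :: 'a \<Rightarrow> real. inj_on g V \<and>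
    (\<forall>a b x y. {a, b} \<in> F \<longrightarrow> {x, y} \<in> F \<longrightarrow> \<not> (g a < g x \<and> g x < g b \<and> g b < g y))"
  using assms
proof (induction rule: forest.induct)
  case forest_empty
  obtain f :: "'a \<Rightarrow> nat" where "inj_on f V"
    using finite_imp_inj_to_nat_seg[OF \<open>finite V\<close>] by blast
  then have "inj_on (\<lambda>v. real (f v)) V" by (simp add: inj_on_def)
  then show ?case by blast
next
  case (forest_leaf F u v)
  have "\<Union>F \<subseteq> V" using forest_leaf.prems by simp
  then obtain g :: "'a \<Rightarrow> real" where inj: "inj_on g V"
    and g: "\<forall>a b x y. {a, b} \<in> F \<longrightarrow> {x, y} \<in> F \<longrightarrow> \<not> (g a < g x \<and> g x < g b \<and> g b < g y)"
    using forest_leaf.IH[OF forest_leaf.prems(1)] by metis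
  have uv: "u \<in> V" "v \<in> V" "u \<noteq> v" "u \<notin> \<Union>F" "\<Union>F \<subseteq> V" using forest_leaf by auto
  \<comment> \<open>\<open>\<delta>\<close> is positive and at most half the distance from
    \<open>g v\<close> to any other label; the entry 1 makes \<open>D\<close> visibly
    nonempty.\<close>
  define D where "D = insert 1 ((\<lambda>w. \<bar>g w - g v\<bar>) ` (V - {v}))"
  define \<delta> where "\<delta> = Min D / 2"
  have D: "finite D" "D \<noteq> {}" using \<open>finite V\<close> by (auto simp: D_def)
  have "0 < d" if "d \<in> D" for d
    using that inj uv(2) by (auto simp: D_def inj_on_def)
  then have pos: "0 < \<delta>" using Min_in[OF D] by (simp add: \<delta>_def)
  have gap: "\<delta> < \<bar>g w - g v\<bar>" if "w \<in> V" "w \<noteq> v" for w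
  proof -
    have "Min D \<le> \<bar>g w - g v\<bar>" using D that by (intro Min_le) (auto simp: D_def)
    then show ?thesis using pos by (simp add: \<delta>_def)
  qed
  \<comment> \<open>As \<open>V\<close> is fixed during the induction, \<open>u\<close> already has
    a label. It may be moved since no edge of \<open>F\<close> contains \<open>u\<close>.\<close>
  define g' where "g' = g(u := g v + \<delta>)"
  have g'v: "g' v = g v" "g' u = g v + \<delta>" using uv(3) by (auto simp: g'_def)
  have between: "\<not> (g' v < g' w \<and> g' w < g' u)" if "w \<in> V" for w
  proof (cases "w = u \<or> w = v")
    case False
    then show ?thesis using gap[OF that] g'v by (auto simp: g'_def)
  qed auto
  have "inj_on g' V"
  proof (rule inj_onI)
    fix a b assume ab: "a \<in> V" "b \<in> V" "g' a = g' b"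
    have ne: "g w \<noteq> g v + \<delta>" if "w \<in> V" for w
      using gap[OF that] pos by (cases "w = v") auto
    show "a = b"
      using ab ne[of a] ne[of b] inj_onD[OF inj] by (auto simp: g'_def split: if_splits)
  qed
  moreover have "\<not> (g' a < g' x \<and> g' x < g' b \<and> g' b < g' y)"
    if ab: "{a, b} \<in> insert {u, v} F" and xy: "{x, y} \<in> insert {u, v} F" for a b x y
  proof
    assume *: "g' a < g' x \<and> g' x < g' b \<and> g' b < g' y"
    have V: "b \<in> V" "x \<in> V" using ab xy uv by (auto simp: doubleton_eq_iff)
    consider "{a, b} = {u, v}" | "{x, y} = {u, v}" | "{a, b} \<in> F" "{x, y} \<in> F"
      using ab xy by blast
    then show False
    proof cases
      case 1
      \<comment> \<open>The new edge runs upwards from \<open>v\<close> to \<open>u\<close>, and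
        \<open>x\<close> would have to lie between them; in the next case it is
        \<open>b\<close>.\<close>
      then have "a = v" "b = u" using * g'v pos by (auto simp: doubleton_eq_iff)
      then show False using between[OF V(2)] * by blast
    next
      case 2
      then have "x = v" "y = u" using * g'v pos by (auto simp: doubleton_eq_iff)
      then show False using between[OF V(1)] * by blast
    next
      case 3
      then have "a \<noteq> u" "b \<noteq> u" "x \<noteq> u" "y \<noteq> u" using uv(4) by blast+
      then have "g a < g x \<and> g x < g b \<and> g b < g y" using * by (simp add: g'_def)
      then show False using g 3 by metis
    qed
  qed
  ultimately show ?case by (intro exI[of _ g'] conjI allI impI)
qed

text \<open>The second pattern in \<open>cross\<close> is the first with the edges exchanged, so
  excluding one pattern for all pairs suffices.\<close>

lemma forest_uncrossed_order:
  assumes "forest F" "finite V" "\<Union>F \<subseteq> V"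
  shows "\<exists>r. vertex_order V r \<and> (\<forall>e\<in>F. \<forall>f\<in>F. \<not> cross r e f)"
proof -
  obtain g :: "'a \<Rightarrow> real" where inj: "inj_on g V"
    and g: "\<forall>a b x y. {a, b} \<in> F \<longrightarrow> {x, y} \<in> F \<longrightarrow> \<not> (g a < g x \<and> g x < g b \<and> g b < g y)"
    using forest_order[OF assms] by metis
  let ?r = "{(x, y). x \<in> V \<and> y \<in> V \<and> g x \<le> g y}"
  have "\<not> cross ?r e f" if "e \<in> F" "f \<in> F" for e f
    unfolding cross_def prec_inj[OF inj] using g that by metis
  then show ?thesis using vertex_order_inj[OF inj] by blast
qed

subsection \<open>Arboricity\<close>

text \<open>Write n for \<open>card C\<close>. If n is at most 2K, a simple graph has at most
  n(n-1)/2 edges, hence at most K(n-1). If n exceeds 2K, \<open>mad\<close> gives at most (K - 1/2)n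
  = Kn - n/2 edges, which is below K(n-1). The surplus 1/2 in \<open>K\<close> is what the second
  case consumes.\<close>

lemma card_edges_within_le:
  assumes G: "graph V E" and ne: "V \<noteq> {}" and K: "mad V E / 2 + 1 / 2 \<le> real K"
    and X: "X \<subseteq> E" and C: "C \<subseteq> V" "C \<noteq> {}"
  shows "int (card {e \<in> X. e \<subseteq> C}) \<le> int K * (int (card C) - 1)"
proof -
  let ?n = "real (card C)" and ?m = "real (card {e \<in> X. e \<subseteq> C})"
  have finC: "finite C" using C(1) G by (auto simp: graph_def intro: finite_subset)
  then have n1: "1 \<le> ?n" using C(2) by (simp add: Suc_le_eq card_gt_0_iff)
  have "?m \<le> real K * (?n - 1)"
  proof (cases "?n \<le> 2 * real K")
    case True
    have "{e \<in> X. e \<subseteq> C} \<subseteq> {B. B \<subseteq> C \<and> card B = 2}"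
    proof
      fix e assume "e \<in> {e \<in> X. e \<subseteq> C}"
      then have "e \<in> X" "e \<subseteq> C" by simp_all
      moreover from this obtain u v where "u \<noteq> v" "e = {u, v}"
        using X graphE[OF G] by (metis subsetD)
      ultimately show "e \<in> {B. B \<subseteq> C \<and> card B = 2}" by simp
    qed
    then have "card {e \<in> X. e \<subseteq> C} \<le> card {B. B \<subseteq> C \<and> card B = 2}"
      by (rule card_mono[rotated]) (use finC in simp)
    also have "\<dots> = card C choose 2" by (rule n_subsets[OF finC])
    finally have "2 * card {e \<in> X. e \<subseteq> C} \<le> card C * (card C - 1)" by (simp add: choose_two)
    then have "real (2 * card {e \<in> X. e \<subseteq> C}) \<le> real (card C * (card C - 1))"
      by (simp only: of_nat_le_iff)
    then have "2 * ?m \<le> ?n * (?n - 1)" using n1 by (simp add: of_nat_diff)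
    also have "\<dots> \<le> 2 * real K * (?n - 1)" using True n1 by (intro mult_right_mono) auto
    finally show ?thesis by simp
  next
    case False
    have "?m \<le> mad V E / 2 * ?n"
      by (rule card_edges_le_mad[OF G ne C(1)]) (use X in auto)
    also have "\<dots> \<le> (real K - 1 / 2) * ?n" using K by (intro mult_right_mono) auto
    also have "\<dots> \<le> real K * (?n - 1)" using False by (simp add: algebra_simps)
    finally show ?thesis .
  qed
  also have "\<dots> = real_of_int (int K * (int (card C) - 1))" by simp
  finally show ?thesis by linarith
qed

text \<open>Summing \<open>card_edges_within_le\<close> over the components of \<open>X\<close>
  turns the terms \<open>card C - 1\<close> into the rank. This is the covering condition for
  \<open>K\<close> copies of the graphic matroid.\<close>

lemma card_le_graphic_rank:
  assumes G: "graph V E" and ne: "V \<noteq> {}" and K: "mad V E / 2 + 1 / 2 \<le> real K"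
    and X: "X \<subseteq> E"
  shows "int (card X) \<le> int K * graphic_rank V X"
proof -
  let ?\<C> = "component V X ` V"
  have fin: "finite V" using G by (simp add: graph_def)
  have C: "C \<subseteq> V" "C \<noteq> {}" if "C \<in> ?\<C>" for C
    using that by (auto simp: component_def)
  have "X \<subseteq> (\<Union>C\<in>?\<C>. {e \<in> X. e \<subseteq> C})"
  proof
    fix e assume e: "e \<in> X"
    then have "e \<in> E" using X by blast
    then obtain u v where uv: "u \<in> V" "v \<in> V" "e = {u, v}" using graphE[OF G] by metis
    then have "e \<subseteq> component V X u" using conn_edge[of u v X] e by (auto simp: component_def)
    then show "e \<in> (\<Union>C\<in>?\<C>. {e \<in> X. e \<subseteq> C})" using e uv(1) by blast
  qed
  moreover have "finite X" using X graph_finite_edges[OF G] by (rule finite_subset)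
  ultimately have "card X \<le> card (\<Union>C\<in>?\<C>. {e \<in> X. e \<subseteq> C})"
    by (intro card_mono) (use fin in auto)
  also have "\<dots> \<le> (\<Sum>C\<in>?\<C>. card {e \<in> X. e \<subseteq> C})"
    by (rule card_UN_le) (use fin in simp)
  finally have "int (card X) \<le> (\<Sum>C\<in>?\<C>. int (card {e \<in> X. e \<subseteq> C}))"
    by (metis of_nat_le_iff of_nat_sum)
  also have "\<dots> \<le> (\<Sum>C\<in>?\<C>. int K * (int (card C) - 1))"
    by (intro sum_mono card_edges_within_le[OF G ne K X] C)
  also have "\<dots> = int K * ((\<Sum>C\<in>?\<C>. int (card C)) - int (card ?\<C>))"
    by (simp add: sum_distrib_left[symmetric] sum_subtractf)
  also have "(\<Sum>C\<in>?\<C>. int (card C)) = int (card (\<Union>?\<C>))"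
  proof -
    have "pairwise disjnt ?\<C>"
    proof (rule pairwiseI)
      fix A B assume AB: "A \<in> ?\<C>" "B \<in> ?\<C>" "A \<noteq> B"
      obtain a where a: "a \<in> V" "A = component V X a" using AB(1) by (rule imageE)
      obtain b where b: "b \<in> V" "B = component V X b" using AB(2) by (rule imageE)
      have "\<not> conn X a b" using AB(3) component_eq_iff[OF a(1) b(1)] a(2) b(2) by simp
      then have "\<not> (conn X a w \<and> conn X b w)" for w by (meson conn_sym conn_trans)
      then show "disjnt A B" unfolding a(2) b(2) disjnt_def component_def by auto
    qed
    then have "card (\<Union>?\<C>) = sum card ?\<C>"
      by (rule card_Union_disjoint) (use C fin in \<open>auto intro: finite_subset\<close>)
    then show ?thesis by simp
  qed
  also have "\<Union>?\<C> = V"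
    using conn_refl by (auto simp: component_def)
  finally show ?thesis by (simp add: graphic_rank_def)
qed

lemma forest_decomposition:
  assumes G: "graph V E" and ne: "V \<noteq> {}" and K: "mad V E / 2 + 1 / 2 \<le> real K"
  shows "\<exists>f. f ` E \<subseteq> {..<K} \<and> (\<forall>i<K. forest {e \<in> E. f e = i})"
proof -
  have cov: "int (card X) \<le> (\<Sum>i<K. graphic_rank V X)" if "X \<subseteq> E" for X
    using card_le_graphic_rank[OF assms that] by simp
  obtain f where f: "f ` E \<subseteq> {..<K}"
    "\<forall>i\<in>{..<K}. graphic_rank V {e \<in> E. f e = i} = int (card {e \<in> E. f e = i})"
    using matroid_union[OF graph_finite_edges[OF G] _ unit_submodular_graphic_rank[OF G] cov]
    by blast
  have "forest {e \<in> E. f e = i}" if "i < K" for i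
    by (rule forest_if_independent[OF graph_subset[OF G]]) (use f(2) that in auto)
  then show ?thesis using f(1) by blast
qed

text \<open>One of the \<open>K\<close> forests dictates the vertex order and fits on one page; the others take two
  star forests each, which fit any order.\<close>

lemma union_page_number_le_forests:
  assumes G: "graph V E" and K: "0 < K" and f: "f ` E \<subseteq> {..<K}"
    and forest: "\<And>i. i < K \<Longrightarrow> forest {e \<in> E. f e = i}"
  shows "union_page_number V E \<le> 2 * K - 1"
proof -
  have fin: "finite V" using G by (simp add: graph_def)
  have "\<Union>{e \<in> E. f e = 0} \<subseteq> V" using graph_edges_subset[OF G] by blast
  then obtain r where r: "vertex_order V r"
    "\<forall>e\<in>{e \<in> E. f e = 0}. \<forall>e'\<in>{e \<in> E. f e = 0}. \<not> cross r e e'"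
    using forest_uncrossed_order[OF forest[OF K] fin] by blast
  have "\<forall>i. \<exists>h :: 'a set \<Rightarrow> bool. i < K \<longrightarrow> (\<forall>b. star_forest {e \<in> {e \<in> E. f e = i}. h e = b})"
    using forest_two_star_forests[OF forest] by blast
  then obtain h :: "nat \<Rightarrow> 'a set \<Rightarrow> bool" where
    h: "\<And>i b. i < K \<Longrightarrow> star_forest {e \<in> {e \<in> E. f e = i}. h i e = b}" by metis
  \<comment> \<open>The whole forest 0 gets the single page \<open>(0, False)\<close>; an edge of
    any other forest is also labelled by its star forest.\<close>
  define k where "k e = (if f e = 0 then (0, False) else (f e, h (f e) e))" for e
  define P where "P = (\<lambda>p. {e \<in> E. k e = p}) ` (k ` E)"
  have "union_embedding V E r P"
    unfolding union_embedding_def linear_embedding_def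
  proof (intro conjI ballI impI notI r(1))
    show "partition_on E P" unfolding P_def by (rule fibres_partition)
    fix p e e' assume p: "p \<in> P" and e: "e \<in> p" "e' \<in> p"
      and sc: "same_component p e e'" and cr: "cross r e e'"
    obtain x where x: "x \<in> E" "p = {e \<in> E. k e = k x}" using p unfolding P_def by blast
    show False
    proof (cases "f x = 0")
      case True
      then have "f e = 0" "f e' = 0" using e x by (auto simp: k_def split: if_splits)
      then show False using r(2) e x(2) cr by blast
    next
      case False
      then have "p = {e \<in> {e \<in> E. f e = f x}. h (f x) e = h (f x) x}"
        using x(2) by (auto simp: k_def split: if_splits)
      moreover have "f x < K" using f x(1) by blast
      ultimately have "star_forest p" using h by metis
      then show False
        using star_forest_share[OF _ e sc] cross_disjoint[OF r(1) cr] by blast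
    qed
  qed
  then have "union_page_number V E \<le> card P" by (rule union_page_number_le)
  also have "\<dots> \<le> card (k ` E)"
    unfolding P_def by (rule card_image_le) (simp add: graph_finite_edges[OF G])
  \<comment> \<open>One page for forest 0 and two for each of the other \<open>K - 1\<close>
    forests.\<close>
  also have "\<dots> \<le> card (insert (0, False) ({1..<K} \<times> (UNIV :: bool set)))"
    by (rule card_mono) (use f in \<open>auto simp: k_def\<close>)
  also have "\<dots> = 2 * K - 1" using K by (simp add: card_cartesian_product)
  finally show ?thesis .
qed

lemma union_page_number_le_mad:
  assumes G: "graph V E" and ne: "V \<noteq> {}"
  shows "real (union_page_number V E) \<le> mad V E + 2"
proof -
  \<comment> \<open>The floor is at least \<open>mad V E / 2 + 1 / 2\<close>, as
    \<open>forest_decomposition\<close> requires, and at most \<open>mad V E / 2 + 3 / 2\<close>, so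
    \<open>2 * K - 1\<close> is at most \<open>mad V E + 2\<close>.\<close>
  define K where "K = nat \<lfloor>mad V E / 2 + 3 / 2\<rfloor>"
  have K: "mad V E / 2 + 1 / 2 \<le> real K" "real K \<le> mad V E / 2 + 3 / 2" "0 < K"
    using mad_nonneg[OF assms] unfolding K_def by linarith+
  obtain f where f: "f ` E \<subseteq> {..<K}" "\<forall>i<K. forest {e \<in> E. f e = i}"
    using forest_decomposition[OF assms K(1)] by blast
  have "union_page_number V E \<le> 2 * K - 1"
    using f by (intro union_page_number_le_forests[OF G K(3)]) auto
  then show ?thesis using K(2,3) by linarith
qed

theorem theorem5:
  fixes V :: "'a set" and E :: "'a set set"
  assumes "graph V E" and "V \<noteq> {}"
  shows "local_page_number V E \<le> local_star_arboricity V E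
       \<and> union_page_number V E \<le> star_arboricity E
       \<and> mad V E / 4 \<le> real (local_page_number V E)
       \<and> real (local_page_number V E) \<le> mad V E / 2 + 2
       \<and> mad V E / 4 \<le> real (union_page_number V E)
       \<and> real (union_page_number V E) \<le> mad V E + 2"
  using local_page_number_le_local_star_arboricity[OF assms(1)]
    union_page_number_le_star_arboricity[OF assms(1)]
    mad_le_local_page_number[OF assms] local_page_number_le_mad[OF assms]
    mad_le_union_page_number[OF assms] union_page_number_le_mad[OF assms]
  by (intro conjI)

end
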